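(* Let $p \in (1, \infty)$, and let $A$ be a nonunital approximately unital $L^p$-operator algebra. (1) Let $\varphi \in A^*$ satisfy $\|\varphi\| = 1$. Then the following are equivalent: (a) $\varphi$ is a state on $A$, that is, $\varphi$ extends to a state on $A^1$. (b) $\varphi(e_t) \to 1$ for every cai $(e_t)_{t \in \Lambda}$ for $A$. (c) $\varphi(e_t) \to 1$ for some cai $(e_t)_{t \in \Lambda}$ for $A$. (d) $\varphi(1_{A^{**}}) = 1$. (2) Every state on $A$ has a unique extension to a state on $A^1$.
   Context: An $L^p$-operator algebra is a (complex) Banach algebra isometrically isomorphic to a norm closed subalgebra of $B(L^p(X,\mu))$ for some measure space $(X,\mu)$. A unital Banach algebra is one with an identity of norm $1$. A cai is a contractive approximate identity (a net $(e_t)$ with $\|e_t\|\le1$, $e_ta\to a$, $ae_t\to a$ for all $a$). Approximately unital means having a cai. Multiplier unitization: for a nonunital approximately unital Banach algebra $A$, $A^1 = A + \mathbb{C}1$ with norm $\|a+\lambda 1\| = \sup\{\|ac+\lambda c\| : c \in A, \|c\|\le 1\}$. A state on a unital Banach algebra is a linear functional $\omega$ with $\|\omega\|=\omega(1)=1$. A state on a nonunital approximately unital $A$ is a norm one functional on $A$ that is the restriction to $A$ of a state on $A^1$. For $1<p<\infty$, $L^p$-operator algebras are Arens regular and, when $A$ is approximately unital, $A^{**}$ has an identity $1_{A^{**}}$ of norm $1$; in (d), $\varphi$ is identified with its canonical weak* continuous extension to $A^{**}$. *)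

theory Defs
  imports "HOL-Analysis.Analysis"
begin

section \<open>Complex Banach algebras\<close>

text \<open>Neither commutativity nor an identity is assumed.\<close>

class complex_banach_algebra = real_normed_algebra + banach +
  fixes scaleC :: "complex \<Rightarrow> 'a \<Rightarrow> 'a" (infixr "*\<^sub>C" 75)
  assumes scaleC_add_right: "c *\<^sub>C (x + y) = c *\<^sub>C x + c *\<^sub>C y"
    and scaleC_add_left: "(c + d) *\<^sub>C x = c *\<^sub>C x + d *\<^sub>C x"
    and scaleC_scaleC: "c *\<^sub>C (d *\<^sub>C x) = (c * d) *\<^sub>C x"
    and scaleR_eq_scaleC: "r *\<^sub>R x = complex_of_real r *\<^sub>C x"
    and mult_scaleC_left: "(c *\<^sub>C x) * y = c *\<^sub>C (x * y)"
    and mult_scaleC_right: "x * (c *\<^sub>C y) = c *\<^sub>C (x * y)"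
    and norm_scaleC: "norm (c *\<^sub>C x) = cmod c * norm x"

definition unital :: "'a::complex_banach_algebra itself \<Rightarrow> bool" where
  "unital _ \<longleftrightarrow> (\<exists>u::'a. norm u = 1 \<and> (\<forall>a. u * a = a \<and> a * u = a))"


section \<open>The space \<open>L\<^sup>p(X,\<mu>)\<close> and its bounded operators\<close>

text \<open>Elements of \<open>L\<^sup>p(X,\<mu>)\<close> are classes of almost everywhere equal functions.  The
  functions are total on the underlying type, and their values outside \<open>space M\<close> are
  irrelevant for the equivalence.\<close>

definition Lp_fun :: "real \<Rightarrow> 'x measure \<Rightarrow> ('x \<Rightarrow> complex) set" where
  "Lp_fun p M = {f \<in> borel_measurable M. integrable M (\<lambda>x. cmod (f x) powr p)}"

definition Lp_class :: "real \<Rightarrow> 'x measure \<Rightarrow> ('x \<Rightarrow> complex) \<Rightarrow> ('x \<Rightarrow> complex) set" where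
  "Lp_class p M f = {g \<in> Lp_fun p M. AE x in M. g x = f x}"

definition Lp :: "real \<Rightarrow> 'x measure \<Rightarrow> ('x \<Rightarrow> complex) set set" where
  "Lp p M = Lp_class p M ` Lp_fun p M"

definition Lp_plus ::
  "real \<Rightarrow> 'x measure \<Rightarrow> ('x \<Rightarrow> complex) set \<Rightarrow> ('x \<Rightarrow> complex) set \<Rightarrow> ('x \<Rightarrow> complex) set" where
  "Lp_plus p M \<xi> \<eta> = {h \<in> Lp_fun p M. \<exists>f\<in>\<xi>. \<exists>g\<in>\<eta>. AE x in M. h x = f x + g x}"

definition Lp_scale ::
  "real \<Rightarrow> 'x measure \<Rightarrow> complex \<Rightarrow> ('x \<Rightarrow> complex) set \<Rightarrow> ('x \<Rightarrow> complex) set" where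
  "Lp_scale p M c \<xi> = {h \<in> Lp_fun p M. \<exists>f\<in>\<xi>. AE x in M. h x = c * f x}"

definition Lp_norm :: "real \<Rightarrow> 'x measure \<Rightarrow> ('x \<Rightarrow> complex) set \<Rightarrow> real" where
  "Lp_norm p M \<xi> = (\<integral>x. cmod ((SOME f. f \<in> \<xi>) x) powr p \<partial>M) powr (1 / p)"

type_synonym 'x Lp_op = "('x \<Rightarrow> complex) set \<Rightarrow> ('x \<Rightarrow> complex) set"

text \<open>Operators are extensional functions on \<open>Lp p M\<close>, so that equality of operators is
  equality on \<open>Lp p M\<close>.\<close>

definition Lp_bounded_ops :: "real \<Rightarrow> 'x measure \<Rightarrow> 'x Lp_op set" where
  "Lp_bounded_ops p M = {T \<in> Lp p M \<rightarrow>\<^sub>E Lp p M.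
     (\<forall>\<xi>\<in>Lp p M. \<forall>\<eta>\<in>Lp p M. T (Lp_plus p M \<xi> \<eta>) = Lp_plus p M (T \<xi>) (T \<eta>)) \<and>
     (\<forall>c. \<forall>\<xi>\<in>Lp p M. T (Lp_scale p M c \<xi>) = Lp_scale p M c (T \<xi>)) \<and>
     (\<exists>K. \<forall>\<xi>\<in>Lp p M. Lp_norm p M (T \<xi>) \<le> K * Lp_norm p M \<xi>)}"

definition Lp_op_norm :: "real \<Rightarrow> 'x measure \<Rightarrow> 'x Lp_op \<Rightarrow> real" where
  "Lp_op_norm p M T = (SUP \<xi>\<in>{\<xi> \<in> Lp p M. Lp_norm p M \<xi> \<le> 1}. Lp_norm p M (T \<xi>))"

definition Lp_op_plus :: "real \<Rightarrow> 'x measure \<Rightarrow> 'x Lp_op \<Rightarrow> 'x Lp_op \<Rightarrow> 'x Lp_op" where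
  "Lp_op_plus p M S T = (\<lambda>\<xi>\<in>Lp p M. Lp_plus p M (S \<xi>) (T \<xi>))"

definition Lp_op_scale :: "real \<Rightarrow> 'x measure \<Rightarrow> complex \<Rightarrow> 'x Lp_op \<Rightarrow> 'x Lp_op" where
  "Lp_op_scale p M c T = (\<lambda>\<xi>\<in>Lp p M. Lp_scale p M c (T \<xi>))"

definition Lp_op_mult :: "real \<Rightarrow> 'x measure \<Rightarrow> 'x Lp_op \<Rightarrow> 'x Lp_op \<Rightarrow> 'x Lp_op" where
  "Lp_op_mult p M S T = compose (Lp p M) S T"

definition Lp_closed_subalgebra :: "real \<Rightarrow> 'x measure \<Rightarrow> 'x Lp_op set \<Rightarrow> bool" where
  "Lp_closed_subalgebra p M B \<longleftrightarrow>
     B \<subseteq> Lp_bounded_ops p M \<and> B \<noteq> {} \<and>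
     (\<forall>S\<in>B. \<forall>T\<in>B. Lp_op_plus p M S T \<in> B \<and> Lp_op_mult p M S T \<in> B) \<and>
     (\<forall>c. \<forall>T\<in>B. Lp_op_scale p M c T \<in> B) \<and>
     (\<forall>T\<in>Lp_bounded_ops p M.
        (\<forall>\<epsilon>>0. \<exists>S\<in>B. Lp_op_norm p M (Lp_op_plus p M T (Lp_op_scale p M (-1) S)) < \<epsilon>) \<longrightarrow> T \<in> B)"

definition Lp_operator_algebra ::
  "real \<Rightarrow> 'x measure \<Rightarrow> 'a::complex_banach_algebra itself \<Rightarrow> bool" where
  "Lp_operator_algebra p M _ \<longleftrightarrow>
     (\<exists>B (\<pi> :: 'a \<Rightarrow> 'x Lp_op). Lp_closed_subalgebra p M B \<and> bij_betw \<pi> UNIV B \<and>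
        (\<forall>a b. \<pi> (a + b) = Lp_op_plus p M (\<pi> a) (\<pi> b)) \<and>
        (\<forall>c a. \<pi> (c *\<^sub>C a) = Lp_op_scale p M c (\<pi> a)) \<and>
        (\<forall>a b. \<pi> (a * b) = Lp_op_mult p M (\<pi> a) (\<pi> b)) \<and>
        (\<forall>a. Lp_op_norm p M (\<pi> a) = norm a))"


section \<open>Contractive approximate identities\<close>

definition directed_set :: "'i set \<Rightarrow> ('i \<Rightarrow> 'i \<Rightarrow> bool) \<Rightarrow> bool" where
  "directed_set \<Lambda> r \<longleftrightarrow> \<Lambda> \<noteq> {} \<and> (\<forall>s\<in>\<Lambda>. r s s) \<and>
     (\<forall>s\<in>\<Lambda>. \<forall>t\<in>\<Lambda>. \<forall>u\<in>\<Lambda>. r s t \<longrightarrow> r t u \<longrightarrow> r s u) \<and>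
     (\<forall>s\<in>\<Lambda>. \<forall>t\<in>\<Lambda>. \<exists>u\<in>\<Lambda>. r s u \<and> r t u)"

text \<open>The filter generated by the tails of \<open>\<Lambda>\<close>; convergence of a net indexed by \<open>\<Lambda>\<close> is
  \<^const>\<open>tendsto\<close> along this filter.\<close>

definition tails :: "'i set \<Rightarrow> ('i \<Rightarrow> 'i \<Rightarrow> bool) \<Rightarrow> 'i filter" where
  "tails \<Lambda> r = (INF s\<in>\<Lambda>. principal {t \<in> \<Lambda>. r s t})"

definition cai ::
  "'i set \<Rightarrow> ('i \<Rightarrow> 'i \<Rightarrow> bool) \<Rightarrow> ('i \<Rightarrow> 'a::complex_banach_algebra) \<Rightarrow> bool" where
  "cai \<Lambda> r e \<longleftrightarrow> directed_set \<Lambda> r \<and> (\<forall>t\<in>\<Lambda>. norm (e t) \<le> 1) \<and>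
     (\<forall>a. ((\<lambda>t. e t * a) \<longlongrightarrow> a) (tails \<Lambda> r) \<and> ((\<lambda>t. a * e t) \<longlongrightarrow> a) (tails \<Lambda> r))"

text \<open>HOL cannot quantify over index types inside a formula, so the type \<open>'i\<close> from which
  index sets are drawn is a parameter.  In a theorem it is a free type variable, hence
  arbitrary.  Nets over different index types can be compared within a common one such as a
  sum type, because index sets are arbitrary subsets of \<open>'i\<close>.\<close>

definition approximately_unital ::
  "'i itself \<Rightarrow> 'a::complex_banach_algebra itself \<Rightarrow> bool" where
  "approximately_unital _ _ \<longleftrightarrow> (\<exists>(\<Lambda>::'i set) r (e::'i \<Rightarrow> 'a). cai \<Lambda> r e)"


section \<open>Bounded functionals, the multiplier unitization and states\<close>

text \<open>The norm and the scalar multiplication are explicit arguments, because the multiplier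
  unitization below is not an instance of a type class of normed spaces.\<close>

definition bounded_functional ::
  "(complex \<Rightarrow> 'v \<Rightarrow> 'v) \<Rightarrow> ('v \<Rightarrow> real) \<Rightarrow> ('v::ab_group_add \<Rightarrow> complex) \<Rightarrow> bool" where
  "bounded_functional sc N f \<longleftrightarrow>
     (\<forall>x y. f (x + y) = f x + f y) \<and> (\<forall>c x. f (sc c x) = c * f x) \<and>
     (\<exists>K. \<forall>x. cmod (f x) \<le> K * N x)"

definition functional_norm :: "('v \<Rightarrow> real) \<Rightarrow> ('v \<Rightarrow> complex) \<Rightarrow> real" where
  "functional_norm N f = (SUP x\<in>{x. N x \<le> 1}. cmod (f x))"

definition dual :: "('a::complex_banach_algebra \<Rightarrow> complex) set" where
  "dual = {f. bounded_functional scaleC norm f}"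

abbreviation dual_norm :: "('a::complex_banach_algebra \<Rightarrow> complex) \<Rightarrow> real" where
  "dual_norm \<equiv> functional_norm norm"

text \<open>In the multiplier unitization of a nonunital algebra, the pair \<open>(a, l)\<close> stands for
  \<open>a + l 1\<close>; thus \<open>a\<close> is embedded as \<open>(a, 0)\<close> and the identity is \<open>(0, 1)\<close>.\<close>

definition unitization_scale ::
  "complex \<Rightarrow> 'a::complex_banach_algebra \<times> complex \<Rightarrow> 'a \<times> complex" where
  "unitization_scale c x = (c *\<^sub>C fst x, c * snd x)"

definition unitization_norm :: "'a::complex_banach_algebra \<times> complex \<Rightarrow> real" where
  "unitization_norm x = (SUP c\<in>{c. norm c \<le> 1}. norm (fst x * c + snd x *\<^sub>C c))"

definition unitization_state :: "('a::complex_banach_algebra \<times> complex \<Rightarrow> complex) \<Rightarrow> bool" where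
  "unitization_state \<omega> \<longleftrightarrow> bounded_functional unitization_scale unitization_norm \<omega> \<and>
     functional_norm unitization_norm \<omega> = 1 \<and> \<omega> (0, 1) = 1"

definition extends :: "('a::complex_banach_algebra \<times> complex \<Rightarrow> complex) \<Rightarrow> ('a \<Rightarrow> complex) \<Rightarrow> bool" where
  "extends \<omega> \<phi> \<longleftrightarrow> (\<forall>a. \<omega> (a, 0) = \<phi> a)"

definition state :: "('a::complex_banach_algebra \<Rightarrow> complex) \<Rightarrow> bool" where
  "state \<phi> \<longleftrightarrow> \<phi> \<in> dual \<and> dual_norm \<phi> = 1 \<and> (\<exists>\<omega>. unitization_state \<omega> \<and> extends \<omega> \<phi>)"


section \<open>The bidual with its Arens product\<close>

text \<open>Elements of the bidual are extensional functions on \<^const>\<open>dual\<close>.\<close>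

definition bidual :: "(('a::complex_banach_algebra \<Rightarrow> complex) \<Rightarrow> complex) set" where
  "bidual = {F \<in> extensional dual.
     (\<forall>f\<in>dual. \<forall>g\<in>dual. F (\<lambda>a. f a + g a) = F f + F g) \<and>
     (\<forall>c. \<forall>f\<in>dual. F (\<lambda>a. c * f a) = c * F f) \<and>
     (\<exists>K. \<forall>f\<in>dual. cmod (F f) \<le> K * dual_norm f)}"

text \<open>The first Arens product: \<open>(f \<cdot> a) b = f (a b)\<close>, \<open>(G \<cdot> f) a = G (f \<cdot> a)\<close> and
  \<open>(F G) f = F (G \<cdot> f)\<close>.  For Arens regular algebras, in particular for
  \<open>L\<^sup>p\<close>-operator algebras with \<open>1 < p < \<infinity>\<close>, it coincides with the second one.\<close>

definition arens ::
  "(('a::complex_banach_algebra \<Rightarrow> complex) \<Rightarrow> complex) \<Rightarrow> (('a \<Rightarrow> complex) \<Rightarrow> complex) \<Rightarrow>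
   (('a \<Rightarrow> complex) \<Rightarrow> complex)" where
  "arens F G = (\<lambda>f\<in>dual. F (\<lambda>a. G (\<lambda>b. f (a * b))))"

definition bidual_one :: "('a::complex_banach_algebra \<Rightarrow> complex) \<Rightarrow> complex" where
  "bidual_one = (THE E. E \<in> bidual \<and> (\<forall>F\<in>bidual. arens E F = F \<and> arens F E = F))"

text \<open>The weak* continuous extension of a functional to the bidual is evaluation at it.\<close>

definition bidual_extension ::
  "('a::complex_banach_algebra \<Rightarrow> complex) \<Rightarrow> (('a \<Rightarrow> complex) \<Rightarrow> complex) \<Rightarrow> complex" where
  "bidual_extension \<phi> F = F \<phi>"

end

theory Submission
  imports Defs
begin

text \<open>Everything rests on the uniform smoothness of \<open>L\<^sup>p\<close>.  If \<open>u\<close> is a unit vector with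
  \<open>e u = u\<close>, where \<open>e\<close> is a contraction, and \<open>w\<close> is any vector, then
  \<open>\<parallel>u + h (w - e w)\<parallel> \<le> (\<parallel>u + 2 h w\<parallel> + \<parallel>e (u - 2 h w)\<parallel>) / 2 \<le> 1 + o(h)\<close>.  Applied to \<open>u = a \<xi>\<close> and
  \<open>w = b \<xi>\<close>, this shows \<open>\<parallel>a + h (b - e b)\<parallel> \<le> 1 + o(h)\<close> uniformly in contractions \<open>a\<close>, \<open>b\<close>, \<open>e\<close> with
  \<open>e a \<approx> a\<close>.  If a functional \<open>f\<close> almost attains its norm at \<open>a\<close>, then \<open>f (b - e b)\<close> must be
  small.  With \<open>b\<close> the identity of \<open>A\<^sup>1\<close> this gives \<open>\<phi> (e\<^sub>t) \<longlonglongrightarrow> 1\<close> for every state \<open>\<phi>\<close>.  Uniformity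
  in \<open>b \<in> A\<close> shows that \<open>f (e\<^sub>t)\<close> is Cauchy for every \<open>f \<in> A\<^sup>*\<close> and that its limit defines a
  two-sided identity for the Arens product.  Conversely, if \<open>\<phi> (e\<^sub>t) \<longlonglongrightarrow> 1\<close>, then
  \<open>a + \<lambda> 1 \<mapsto> \<phi> a + \<lambda>\<close> is the limit of the contractions \<open>x \<mapsto> \<phi> (x e\<^sub>t)\<close>, hence a state.\<close>


section \<open>A pointwise smoothness inequality\<close>

text \<open>This is convexity on the open half-line, with the endpoint 0 treated by hand. There
  \<open>0 powr (q - 1)\<close> is 0 even for \<open>q = 1\<close>, so the case \<open>x = 0\<close>
  only says that \<open>y powr q\<close> is nonnegative.\<close>

lemma powr_above_tangent:
  fixes x y q :: real
  assumes "1 \<le> q" "0 \<le> x" "0 \<le> y"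
  shows "x powr q + q * x powr (q - 1) * (y - x) \<le> y powr q"
proof -
  consider "x = 0" | "x > 0" "y = 0" | "x > 0" "y > 0"
    using assms by linarith
  then show ?thesis
  proof cases
    case 1
    then show ?thesis by simp
  next
    case 2
    have "x powr (q - 1) * x = x powr q"
      using 2 by (simp add: powr_mult_base[of x "q - 1"] mult.commute)
    moreover have "x powr q \<le> q * x powr q"
      using assms by (simp add: mult_le_cancel_right1)
    ultimately show ?thesis
      using 2 by (simp add: mult.assoc)
  next
    case 3
    have "y powr q - x powr q \<ge> (q * x powr (q - 1)) * (y - x)"
    proof (rule convex_on_imp_above_tangent[where A = "{0<..}"])
      show "convex_on {0<..} (\<lambda>x. x powr q)"
        by (rule powr_convex[OF assms(1)])
      show "((\<lambda>x. x powr q) has_real_derivative q * x powr (q - 1)) (at x within {0<..})"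
        using 3 by (auto intro!: derivative_eq_intros)
    qed (use 3 in \<open>auto simp: interior_open\<close>)
    then show ?thesis by simp
  qed
qed

text \<open>Jensen's inequality from the tangent at the mean \<open>w\<close>: the linear terms
  cancel after weighting by \<open>l\<close> and \<open>m\<close>.\<close>

lemma powr_convex_combination:
  fixes u v l m q :: real
  assumes "1 \<le> q" "0 \<le> u" "0 \<le> v" "0 \<le> l" "0 \<le> m" "l + m = 1"
  shows "(l * u + m * v) powr q \<le> l * u powr q + m * v powr q"
proof -
  define w where "w = l * u + m * v"
  have w: "0 \<le> w" using assms by (simp add: w_def)
  have "w powr q = l * (w powr q + q * w powr (q - 1) * (u - w)) + m * (w powr q + q * w powr (q - 1) * (v - w))"
  proof -
    have "l * (w powr q + q * w powr (q - 1) * (u - w)) + m * (w powr q + q * w powr (q - 1) * (v - w))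
        = (l + m) * w powr q + q * w powr (q - 1) * ((l * u + m * v) - (l + m) * w)"
      by (simp add: algebra_simps)
    then show ?thesis using assms by (simp add: w_def)
  qed
  also have "\<dots> \<le> l * u powr q + m * v powr q"
    using powr_above_tangent[of q w] assms w by (intro add_mono mult_left_mono) auto
  finally show ?thesis by (simp add: w_def)
qed

text \<open>After division by \<open>s = x + y\<close> both numbers lie in [0, 1], where
  \<open>z \<le> z powr q\<close> for exponents at most 1.\<close>

lemma powr_add_le_add_powr:
  fixes x y q :: real
  assumes "0 < q" "q \<le> 1" "0 \<le> x" "0 \<le> y"
  shows "(x + y) powr q \<le> x powr q + y powr q"
proof (cases "x + y = 0")
  case True
  then show ?thesis by simp
next
  case False
  define s where "s = x + y"
  have s: "s > 0" using False assms by (simp add: s_def)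
  have le: "z / s \<le> (z / s) powr q" if "0 \<le> z" "z \<le> s" for z
    using powr_mono'[of q 1 "z / s"] that s assms by (cases "z = 0") auto
  have "1 = x / s + y / s"
    using s by (simp add: s_def add_divide_distrib[symmetric])
  also have "\<dots> \<le> (x / s) powr q + (y / s) powr q"
    using assms by (intro add_mono le) (auto simp: s_def)
  finally have "1 \<le> (x powr q + y powr q) / s powr q"
    using s assms by (simp add: powr_divide add_divide_distrib)
  then show ?thesis using s by (simp add: s_def)
qed

lemma powr_eq_square_powr:
  fixes x :: real
  assumes "0 \<le> x"
  shows "x powr p = (x\<^sup>2) powr (p / 2)"
proof -
  have "(x\<^sup>2) powr (p / 2) = (x powr 2) powr (p / 2)"
    using assms by simp
  then show ?thesis by (simp only: powr_powr) simp
qed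

text \<open>With squared moduli, the two signs differ only in a real cross term, so real
  inequalities for the exponent \<open>p / 2\<close> apply.\<close>

lemma cmod_add_powr:
  fixes s t :: complex
  shows "cmod (s + t) powr p = ((cmod s)\<^sup>2 + (cmod t)\<^sup>2 + 2 * Re (s * cnj t)) powr (p / 2)"
    and "cmod (s - t) powr p = ((cmod s)\<^sup>2 + (cmod t)\<^sup>2 - 2 * Re (s * cnj t)) powr (p / 2)"
proof -
  show "cmod (s + t) powr p = ((cmod s)\<^sup>2 + (cmod t)\<^sup>2 + 2 * Re (s * cnj t)) powr (p / 2)"
    unfolding powr_eq_square_powr[OF norm_ge_zero, of "s + t"]
    by (rule arg_cong[where f = "\<lambda>x. x powr (p / 2)"]) (simp add: cmod_power2, algebra)
  show "cmod (s - t) powr p = ((cmod s)\<^sup>2 + (cmod t)\<^sup>2 - 2 * Re (s * cnj t)) powr (p / 2)"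
    unfolding powr_eq_square_powr[OF norm_ge_zero, of "s - t"]
    by (rule arg_cong[where f = "\<lambda>x. x powr (p / 2)"]) (simp add: cmod_power2, algebra)
qed

text \<open>The power mean inequality and the parallelogram law bound the average by (|s|^2 + |h
  t|^2)^(p/2). Since p/2 is at most 1, this is at most |s|^p + h^p |t|^p, and h^p is o(h) because p
  > 1.\<close>

lemma cmod_smooth_le_2:
  fixes p \<epsilon> :: real
  assumes "1 < p" "p \<le> 2" "0 < \<epsilon>"
  shows "\<exists>h>0. \<forall>s t :: complex. (cmod (s + of_real h * t) powr p + cmod (s - of_real h * t) powr p) / 2
           \<le> cmod s powr p + \<epsilon> * h * (cmod s powr p + cmod t powr p)"
proof -
  \<comment> \<open>Solves \<open>h powr (p - 1) = \<epsilon>\<close>, which turns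
    \<open>h powr p\<close> into \<open>\<epsilon> * h\<close>.\<close>
  define h where "h = \<epsilon> powr (1 / (p - 1))"
  have h: "h > 0" using assms by (simp add: h_def)
  have "h powr p = h powr (p - 1) * h"
    using h by (metis add.commute diff_add_cancel powr_add powr_one less_imp_le)
  also have "h powr (p - 1) = \<epsilon>"
    using assms by (simp add: h_def powr_powr)
  finally have hp: "h powr p = \<epsilon> * h" .
  have "(cmod (s + of_real h * t) powr p + cmod (s - of_real h * t) powr p) / 2
      \<le> cmod s powr p + \<epsilon> * h * (cmod s powr p + cmod t powr p)" for s t :: complex
  proof -
    define X where "X = (cmod s)\<^sup>2 + (cmod (of_real h * t))\<^sup>2"
    define A where "A = cmod (s + of_real h * t)"
    define B where "B = cmod (s - of_real h * t)"
    have AB: "(A\<^sup>2 + B\<^sup>2) / 2 = X"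
      unfolding A_def B_def X_def by (simp add: cmod_power2, algebra)
    \<comment> \<open>The exponent \<open>2 / p\<close> is at least 1, so Jensen compares the mean
      of p-th powers with the mean of squares.\<close>
    have "((A powr p + B powr p) / 2) powr (2 / p) \<le> ((A powr p) powr (2 / p) + (B powr p) powr (2 / p)) / 2"
      using powr_convex_combination[of "2 / p" "A powr p" "B powr p" "1/2" "1/2"] assms
      by (simp add: add_divide_distrib)
    also have "\<dots> = X"
      using AB assms by (simp add: powr_powr A_def B_def)
    finally have "(((A powr p + B powr p) / 2) powr (2 / p)) powr (p / 2) \<le> X powr (p / 2)"
      using assms by (intro powr_mono2) auto
    then have "(A powr p + B powr p) / 2 \<le> X powr (p / 2)"
      using assms by (simp add: powr_powr)
    also have "\<dots> \<le> ((cmod s)\<^sup>2) powr (p / 2) + ((cmod (of_real h * t))\<^sup>2) powr (p / 2)"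
      unfolding X_def using assms by (intro powr_add_le_add_powr) auto
    also have "\<dots> = cmod s powr p + h powr p * cmod t powr p"
      using h by (simp add: powr_eq_square_powr[of _ p, symmetric] norm_mult powr_mult)
    also have "\<dots> \<le> cmod s powr p + \<epsilon> * h * (cmod s powr p + cmod t powr p)"
      using h assms by (simp add: hp distrib_left)
    finally show ?thesis by (simp add: A_def B_def)
  qed
  then show ?thesis using h by blast
qed

text \<open>The average is that of (X + Y)^q and (X - Y)^q with q = p/2 > 1 and |Y| at most 2h.
  Tangents bound the sum by 2 X^q plus q Y times the difference of (X + Y)^(q-1) and (X - Y)^(q-1).
  Uniform continuity of x^(q-1) on a compact interval makes this term o(h); the bounds on
  \<open>s\<close> and \<open>t\<close> supply the compactness.\<close>

lemma cmod_smooth_gt_2_unit: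
  fixes p \<epsilon> :: real
  assumes "2 < p" "0 < \<epsilon>"
  shows "\<exists>h>0. \<forall>s t :: complex. cmod s \<le> 1 \<longrightarrow> cmod t \<le> 1 \<longrightarrow>
           (cmod (s + of_real h * t) powr p + cmod (s - of_real h * t) powr p) / 2
           \<le> cmod s powr p + \<epsilon> * h"
proof -
  define q where "q = p / 2"
  have q: "1 < q" using assms by (simp add: q_def)
  have "uniformly_continuous_on {0..4} (\<lambda>x::real. x powr (q - 1))"
    using q by (intro compact_uniformly_continuous continuous_on_powr') (auto intro: continuous_intros)
  moreover have "0 < \<epsilon> / (2 * q)" using q assms by simp
  ultimately obtain d where d: "d > 0"
    and dq: "\<And>x y. x \<in> {0..4} \<Longrightarrow> y \<in> {0..4} \<Longrightarrow> dist y x < d \<Longrightarrow>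
        dist (y powr (q - 1)) (x powr (q - 1)) < \<epsilon> / (2 * q)"
    unfolding uniformly_continuous_on_def by metis
  \<comment> \<open>The bound 1 keeps \<open>X + Y\<close> and \<open>X - Y\<close> in [0, 4];
    \<open>d / 5\<close> brings these points, at most \<open>4 * h\<close> apart, within
    \<open>d\<close>; the last bound makes the quadratic error at most
    \<open>\<epsilon> / 2 * h\<close>.\<close>
  define h where "h = min 1 (min (d / 5) (\<epsilon> / (2 * q * 2 powr (q - 1))))"
  have h: "0 < h" "h \<le> 1" "4 * h < d" "q * 2 powr (q - 1) * h \<le> \<epsilon> / 2"
  proof -
    show "0 < h" "h \<le> 1" using d q assms by (auto simp: h_def)
    have "h \<le> d / 5" by (simp add: h_def)
    then show "4 * h < d" using d by simp
    have "h \<le> \<epsilon> / (2 * q * 2 powr (q - 1))" by (simp add: h_def)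
    then show "q * 2 powr (q - 1) * h \<le> \<epsilon> / 2"
      using q by (simp add: field_simps)
  qed
  have "(cmod (s + of_real h * t) powr p + cmod (s - of_real h * t) powr p) / 2 \<le> cmod s powr p + \<epsilon> * h"
    if st: "cmod s \<le> 1" "cmod t \<le> 1" for s t :: complex
  proof -
    define X where "X = (cmod s)\<^sup>2 + (cmod (of_real h * t))\<^sup>2"
    define Y where "Y = 2 * Re (s * cnj (of_real h * t))"
    have ht: "cmod (of_real h * t) \<le> h" using h st by (simp add: norm_mult mult_left_le)
    have s2: "(cmod s)\<^sup>2 \<le> 1" using st by (simp add: power_le_one)
    have ht2: "(cmod (of_real h * t))\<^sup>2 \<le> h\<^sup>2" using ht by (simp add: power_mono)
    have h2: "h\<^sup>2 \<le> 1" using h by (simp add: power_le_one)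
    have X: "0 \<le> X" "X \<le> 2" using s2 ht2 h2 by (auto simp: X_def)
    have "\<bar>Re (s * cnj (of_real h * t))\<bar> \<le> cmod s * cmod (of_real h * t)"
      using abs_Re_le_cmod[of "s * cnj (of_real h * t)"] by (simp add: norm_mult)
    moreover have "2 * (cmod s * cmod (of_real h * t)) \<le> X"
      using sum_squares_bound[of "cmod s" "cmod (of_real h * t)"] by (simp add: X_def)
    moreover have "cmod s * cmod (of_real h * t) \<le> 1 * h"
      using st ht by (intro mult_mono) auto
    ultimately have Y: "\<bar>Y\<bar> \<le> X" "\<bar>Y\<bar> \<le> 2 * h" by (auto simp: Y_def)
    have p: "0 \<le> X + Y" "0 \<le> X - Y" "X + Y \<le> 4" "X - Y \<le> 4" using X Y by linarith+
    \<comment> \<open>The tangents are drawn at the perturbed points and evaluated at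
      \<open>X\<close>, which bounds the perturbed powers from above.\<close>
    have t1: "(X + Y) powr q - q * (X + Y) powr (q - 1) * Y \<le> X powr q"
      using powr_above_tangent[of q "X + Y" X] q X p by simp
    have t2: "(X - Y) powr q + q * (X - Y) powr (q - 1) * Y \<le> X powr q"
      using powr_above_tangent[of q "X - Y" X] q X p by simp
    have "\<bar>(X + Y) powr (q - 1) - (X - Y) powr (q - 1)\<bar> \<le> \<epsilon> / (2 * q)"
    proof -
      have "dist (X + Y) (X - Y) < d" using Y h by (simp add: dist_real_def)
      then show ?thesis using dq[of "X - Y" "X + Y"] p by (simp add: dist_real_def)
    qed
    then have "\<bar>Y * ((X + Y) powr (q - 1) - (X - Y) powr (q - 1))\<bar> \<le> (2 * h) * (\<epsilon> / (2 * q))"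
      unfolding abs_mult using Y h by (intro mult_mono) auto
    then have "q * (Y * ((X + Y) powr (q - 1) - (X - Y) powr (q - 1))) \<le> q * ((2 * h) * (\<epsilon> / (2 * q)))"
      using q by (intro mult_left_mono) auto
    then have diff: "q * (Y * ((X + Y) powr (q - 1) - (X - Y) powr (q - 1))) \<le> \<epsilon> * h"
      using q by (simp add: mult.commute)
    \<comment> \<open>The same device at \<open>X\<close>, evaluated at |s|^2: replacing
      \<open>X\<close> by |s|^2 costs only a multiple of \<open>h\<^sup>2\<close>.\<close>
    have "X powr q + q * X powr (q - 1) * ((cmod s)\<^sup>2 - X) \<le> ((cmod s)\<^sup>2) powr q"
      using q X by (intro powr_above_tangent) auto
    also have "((cmod s)\<^sup>2) powr q = cmod s powr p"
      by (simp add: q_def powr_eq_square_powr[of _ p])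
    finally have "X powr q \<le> cmod s powr p + q * X powr (q - 1) * (cmod (of_real h * t))\<^sup>2"
      by (simp add: X_def algebra_simps)
    also have "\<dots> \<le> cmod s powr p + q * 2 powr (q - 1) * h\<^sup>2"
      using q X ht2 by (intro add_left_mono mult_mono powr_mono2) auto
    also have "\<dots> = cmod s powr p + (q * 2 powr (q - 1) * h) * h"
      by (simp add: power2_eq_square)
    also have "\<dots> \<le> cmod s powr p + \<epsilon> / 2 * h"
      using h by (intro add_left_mono mult_right_mono) auto
    finally have Xq: "X powr q \<le> cmod s powr p + \<epsilon> / 2 * h" .
    have "(X + Y) powr q + (X - Y) powr q \<le> 2 * X powr q
        + q * (Y * ((X + Y) powr (q - 1) - (X - Y) powr (q - 1)))"
      using t1 t2 by (simp add: algebra_simps)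
    then have "(X + Y) powr q + (X - Y) powr q \<le> 2 * (cmod s powr p + \<epsilon> * h)"
      using diff Xq by simp
    then show ?thesis
      unfolding cmod_add_powr X_def[symmetric] Y_def[symmetric] q_def[symmetric] by simp
  qed
  then show ?thesis using h by blast
qed

text \<open>Both sides are homogeneous of degree \<open>p\<close> in the pair of \<open>s\<close>
  and \<open>t\<close>, so for \<open>p > 2\<close> division by the larger modulus \<open>m\<close>
  reduces to the unit disc. The error then carries the factor \<open>m powr p\<close>, which is the
  p-th power of one of the two moduli.\<close>

lemma cmod_smooth:
  fixes p \<epsilon> :: real
  assumes "1 < p" "0 < \<epsilon>"
  shows "\<exists>h>0. \<forall>s t :: complex. (cmod (s + of_real h * t) powr p + cmod (s - of_real h * t) powr p) / 2
           \<le> cmod s powr p + \<epsilon> * h * (cmod s powr p + cmod t powr p)"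
proof (cases "p \<le> 2")
  case True
  then show ?thesis using cmod_smooth_le_2 assms by blast
next
  case False
  then obtain h where h: "h > 0" and hst: "\<And>s t :: complex. cmod s \<le> 1 \<Longrightarrow> cmod t \<le> 1 \<Longrightarrow>
           (cmod (s + of_real h * t) powr p + cmod (s - of_real h * t) powr p) / 2
           \<le> cmod s powr p + \<epsilon> * h"
    using cmod_smooth_gt_2_unit[of p \<epsilon>] assms by auto
  have "(cmod (s + of_real h * t) powr p + cmod (s - of_real h * t) powr p) / 2
           \<le> cmod s powr p + \<epsilon> * h * (cmod s powr p + cmod t powr p)" for s t :: complex
  proof -
    define m where "m = max (cmod s) (cmod t)"
    show ?thesis
    proof (cases "m = 0")
      case True
      then have "s = 0" "t = 0" unfolding m_def
        by (smt (verit) norm_ge_zero norm_eq_zero)+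
      then show ?thesis by simp
    next
      case False
      then have m: "m > 0" by (smt (verit) m_def norm_ge_zero)
      have sc: "cmod (of_real m * z) powr p = m powr p * cmod z powr p" for z
        using m by (simp add: norm_mult powr_mult)
      define s' t' where "s' = s / of_real m" and "t' = t / of_real m"
      have st: "s = of_real m * s'" "t = of_real m * t'"
        using m by (simp_all add: s'_def t'_def)
      have eq: "s + of_real h * t = of_real m * (s' + of_real h * t')"
        "s - of_real h * t = of_real m * (s' - of_real h * t')"
        by (simp_all add: st algebra_simps)
      have "cmod s' \<le> 1" "cmod t' \<le> 1"
        using m by (simp_all add: s'_def t'_def norm_divide m_def)
      from hst[OF this]
      have "m powr p * ((cmod (s' + of_real h * t') powr p + cmod (s' - of_real h * t') powr p) / 2)
          \<le> m powr p * (cmod s' powr p + \<epsilon> * h)"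
        by (intro mult_left_mono) auto
      then have "(cmod (s + of_real h * t) powr p + cmod (s - of_real h * t) powr p) / 2
          \<le> cmod s powr p + \<epsilon> * h * m powr p"
        unfolding eq sc unfolding st(1) sc by (simp add: algebra_simps)
      also have "m powr p \<le> cmod s powr p + cmod t powr p"
        by (auto simp: m_def max_def)
      finally show ?thesis using h assms by (simp add: mult_left_mono)
    qed
  qed
  then show ?thesis using h by blast
qed


section \<open>Uniform smoothness of \<open>L\<^sup>p\<close>\<close>

lemma Lp_fun_integrable: "f \<in> Lp_fun p M \<Longrightarrow> integrable M (\<lambda>x. cmod (f x) powr p)"
  by (simp add: Lp_fun_def)

lemma Lp_fun_measurable: "f \<in> Lp_fun p M \<Longrightarrow> f \<in> borel_measurable M"
  by (simp add: Lp_fun_def)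

lemma Lp_fun_zero: "(\<lambda>x. 0) \<in> Lp_fun p M"
  by (simp add: Lp_fun_def)

lemma Lp_fun_scale:
  assumes "f \<in> Lp_fun p M"
  shows "(\<lambda>x. c * f x) \<in> Lp_fun p M"
  using assms by (auto simp: Lp_fun_def norm_mult powr_mult intro!: borel_measurable_times)

lemma cmod_add_powr_le:
  assumes "1 \<le> p" "0 \<le> l" "0 \<le> m" "l + m = 1"
  shows "cmod (of_real l * s + of_real m * t) powr p \<le> l * cmod s powr p + m * cmod t powr p"
proof -
  have "cmod (of_real l * s + of_real m * t) \<le> l * cmod s + m * cmod t"
    using norm_triangle_ineq[of "of_real l * s" "of_real m * t"] assms by (simp add: norm_mult)
  then have "cmod (of_real l * s + of_real m * t) powr p \<le> (l * cmod s + m * cmod t) powr p"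
    using assms by (intro powr_mono2) auto
  also have "\<dots> \<le> l * cmod s powr p + m * cmod t powr p"
    using assms by (intro powr_convex_combination) auto
  finally show ?thesis .
qed

lemma Lp_fun_convex:
  assumes "1 \<le> p" "f \<in> Lp_fun p M" "g \<in> Lp_fun p M" "0 \<le> l" "0 \<le> m" "l + m = 1"
  shows "(\<lambda>x. of_real l * f x + of_real m * g x) \<in> Lp_fun p M"
    and "(\<integral>x. cmod (of_real l * f x + of_real m * g x) powr p \<partial>M)
      \<le> l * (\<integral>x. cmod (f x) powr p \<partial>M) + m * (\<integral>x. cmod (g x) powr p \<partial>M)"
proof -
  note [measurable] = Lp_fun_measurable[OF assms(2)] Lp_fun_measurable[OF assms(3)]
  note int = Lp_fun_integrable[OF assms(2)] Lp_fun_integrable[OF assms(3)]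
  have int': "integrable M (\<lambda>x. l * cmod (f x) powr p + m * cmod (g x) powr p)"
    using int by simp
  have int'': "integrable M (\<lambda>x. cmod (of_real l * f x + of_real m * g x) powr p)"
    by (rule Bochner_Integration.integrable_bound[OF int'])
      (use cmod_add_powr_le assms in \<open>auto intro!: AE_I2 simp: abs_of_nonneg\<close>)
  then show "(\<lambda>x. of_real l * f x + of_real m * g x) \<in> Lp_fun p M"
    by (simp add: Lp_fun_def)
  have "(\<integral>x. cmod (of_real l * f x + of_real m * g x) powr p \<partial>M)
      \<le> (\<integral>x. l * cmod (f x) powr p + m * cmod (g x) powr p \<partial>M)"
    by (rule integral_mono[OF int'' int']) (use cmod_add_powr_le assms in blast)
  then show "(\<integral>x. cmod (of_real l * f x + of_real m * g x) powr p \<partial>M)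
      \<le> l * (\<integral>x. cmod (f x) powr p \<partial>M) + m * (\<integral>x. cmod (g x) powr p \<partial>M)"
    using int by simp
qed

text \<open>The sum is twice the midpoint, which \<open>Lp_fun_convex\<close> controls.\<close>

lemma Lp_fun_add:
  assumes "1 \<le> p" "f \<in> Lp_fun p M" "g \<in> Lp_fun p M"
  shows "(\<lambda>x. f x + g x) \<in> Lp_fun p M"
  using Lp_fun_scale[OF Lp_fun_convex(1)[OF assms, of "1/2" "1/2"], of 2]
  by (simp add: algebra_simps)

lemma Lp_class_self: "f \<in> Lp_fun p M \<Longrightarrow> f \<in> Lp_class p M f"
  by (simp add: Lp_class_def)

text \<open>\<open>Lp_norm\<close> integrates a representative picked by \<open>SOME\<close>; almost
  everywhere equality makes the choice immaterial.\<close>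

lemma Lp_norm_Lp_class:
  assumes "f \<in> Lp_fun p M"
  shows "Lp_norm p M (Lp_class p M f) = (\<integral>x. cmod (f x) powr p \<partial>M) powr (1 / p)"
proof -
  define g where "g = (SOME g. g \<in> Lp_class p M f)"
  have "g \<in> Lp_class p M f"
    unfolding g_def by (rule someI[where P = "\<lambda>g. g \<in> Lp_class p M f", OF Lp_class_self[OF assms]])
  then have g: "g \<in> Lp_fun p M" "AE x in M. g x = f x"
    by (simp_all add: Lp_class_def)
  note [measurable] = Lp_fun_measurable[OF assms] Lp_fun_measurable[OF g(1)]
  have "(\<integral>x. cmod (g x) powr p \<partial>M) = (\<integral>x. cmod (f x) powr p \<partial>M)"
    by (rule integral_cong_AE) (use g(2) in auto)
  then show ?thesis by (simp add: Lp_norm_def g_def)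
qed

lemma Lp_plus_Lp_class:
  assumes "f \<in> Lp_fun p M" "g \<in> Lp_fun p M"
  shows "Lp_plus p M (Lp_class p M f) (Lp_class p M g) = Lp_class p M (\<lambda>x. f x + g x)"
proof (intro set_eqI iffI)
  fix h assume "h \<in> Lp_plus p M (Lp_class p M f) (Lp_class p M g)"
  then obtain f' g' where h: "h \<in> Lp_fun p M" "AE x in M. f' x = f x" "AE x in M. g' x = g x"
    "AE x in M. h x = f' x + g' x"
    by (auto simp: Lp_plus_def Lp_class_def)
  from h(2-4) have "AE x in M. h x = f x + g x" by eventually_elim simp
  with h(1) show "h \<in> Lp_class p M (\<lambda>x. f x + g x)" by (simp add: Lp_class_def)
next
  fix h assume "h \<in> Lp_class p M (\<lambda>x. f x + g x)"
  then show "h \<in> Lp_plus p M (Lp_class p M f) (Lp_class p M g)"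
    using Lp_class_self assms by (auto simp: Lp_plus_def Lp_class_def)
qed

lemma Lp_scale_Lp_class:
  assumes "f \<in> Lp_fun p M"
  shows "Lp_scale p M c (Lp_class p M f) = Lp_class p M (\<lambda>x. c * f x)"
proof (intro set_eqI iffI)
  fix h assume "h \<in> Lp_scale p M c (Lp_class p M f)"
  then obtain f' where h: "h \<in> Lp_fun p M" "AE x in M. f' x = f x" "AE x in M. h x = c * f' x"
    by (auto simp: Lp_scale_def Lp_class_def)
  from h(2-3) have "AE x in M. h x = c * f x" by eventually_elim simp
  with h(1) show "h \<in> Lp_class p M (\<lambda>x. c * f x)" by (simp add: Lp_class_def)
next
  fix h assume "h \<in> Lp_class p M (\<lambda>x. c * f x)"
  then show "h \<in> Lp_scale p M c (Lp_class p M f)"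
    using Lp_class_self assms by (auto simp: Lp_scale_def Lp_class_def)
qed

lemma LpE:
  assumes "\<xi> \<in> Lp p M"
  obtains f where "f \<in> Lp_fun p M" "\<xi> = Lp_class p M f"
  using assms by (auto simp: Lp_def)

lemma Lp_plus_in_Lp:
  assumes "1 \<le> p" "\<xi> \<in> Lp p M" "\<eta> \<in> Lp p M"
  shows "Lp_plus p M \<xi> \<eta> \<in> Lp p M"
  using assms(2,3) by (elim LpE) (simp add: Lp_plus_Lp_class Lp_def Lp_fun_add[OF assms(1)])

lemma Lp_scale_in_Lp:
  assumes "\<xi> \<in> Lp p M"
  shows "Lp_scale p M c \<xi> \<in> Lp p M"
  using assms by (elim LpE) (simp add: Lp_scale_Lp_class Lp_def Lp_fun_scale)

lemma Lp_norm_nonneg: "0 \<le> Lp_norm p M \<xi>"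
  by (simp add: Lp_norm_def)

lemma Lp_norm_powr:
  assumes "0 < p" "f \<in> Lp_fun p M"
  shows "Lp_norm p M (Lp_class p M f) powr p = (\<integral>x. cmod (f x) powr p \<partial>M)"
proof -
  have "0 \<le> (\<integral>x. cmod (f x) powr p \<partial>M)" by simp
  then show ?thesis using assms by (simp add: Lp_norm_Lp_class powr_powr)
qed

lemma Lp_norm_scale:
  assumes "0 < p" "\<xi> \<in> Lp p M"
  shows "Lp_norm p M (Lp_scale p M c \<xi>) = cmod c * Lp_norm p M \<xi>"
  using assms(2)
proof (rule LpE)
  fix f assume f: "f \<in> Lp_fun p M" "\<xi> = Lp_class p M f"
  show ?thesis
    using f assms(1)
    by (simp add: Lp_scale_Lp_class Lp_norm_Lp_class Lp_fun_scale norm_mult powr_mult powr_powr)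
qed

lemma le_one_iff_powr_le_one:
  fixes x p :: real
  assumes "0 < p" "0 \<le> x"
  shows "x \<le> 1 \<longleftrightarrow> x powr p \<le> 1"
proof (cases "x \<le> 1")
  case True
  then show ?thesis using assms powr_mono2[of p x 1] by simp
next
  case False
  then have "1 powr p < x powr p" using assms by (intro powr_less_mono2) auto
  then show ?thesis using False by simp
qed

text \<open>Pointwise convexity of the p-th power, integrated. Convexity of the unit ball then gives
  Minkowski's inequality by scaling.\<close>

lemma Lp_norm_convex:
  assumes "1 \<le> p" "\<xi> \<in> Lp p M" "\<eta> \<in> Lp p M" "0 \<le> l" "0 \<le> m" "l + m = 1"
    "Lp_norm p M \<xi> \<le> 1" "Lp_norm p M \<eta> \<le> 1"
  shows "Lp_norm p M (Lp_plus p M (Lp_scale p M (of_real l) \<xi>) (Lp_scale p M (of_real m) \<eta>)) \<le> 1"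
proof -
  obtain f where f: "f \<in> Lp_fun p M" "\<xi> = Lp_class p M f" using assms(2) by (rule LpE)
  obtain g where g: "g \<in> Lp_fun p M" "\<eta> = Lp_class p M g" using assms(3) by (rule LpE)
  define k where "k = (\<lambda>x. of_real l * f x + of_real m * g x)"
  have k: "k \<in> Lp_fun p M" unfolding k_def
    using assms f g by (intro Lp_fun_convex) auto
  have fg: "(\<integral>x. cmod (f x) powr p \<partial>M) \<le> 1" "(\<integral>x. cmod (g x) powr p \<partial>M) \<le> 1"
    using assms f g le_one_iff_powr_le_one[OF _ Lp_norm_nonneg, of p p M]
    by (auto simp: Lp_norm_powr)
  have "(\<integral>x. cmod (k x) powr p \<partial>M)
      \<le> l * (\<integral>x. cmod (f x) powr p \<partial>M) + m * (\<integral>x. cmod (g x) powr p \<partial>M)"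
    unfolding k_def using assms f g by (intro Lp_fun_convex) auto
  also have "\<dots> \<le> l * 1 + m * 1"
    using fg assms by (intro add_mono mult_left_mono) auto
  finally have "Lp_norm p M (Lp_class p M k) \<le> 1"
    using assms k le_one_iff_powr_le_one[OF _ Lp_norm_nonneg, of p p M]
    by (simp add: Lp_norm_powr)
  then show ?thesis
    using f g by (simp add: Lp_scale_Lp_class Lp_plus_Lp_class Lp_fun_scale k_def)
qed

text \<open>The convex combination of \<xi>/\<alpha> and \<eta>/\<beta> with weights
  \<alpha>/(\<alpha>+\<beta>) and \<beta>/(\<alpha>+\<beta>) is (\<xi>+\<eta>)/(\<alpha>+\<beta>),
  which therefore lies in the unit ball.\<close>

lemma Lp_norm_plus_le:
  assumes "1 \<le> p" "\<xi> \<in> Lp p M" "\<eta> \<in> Lp p M"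
  shows "Lp_norm p M (Lp_plus p M \<xi> \<eta>) \<le> Lp_norm p M \<xi> + Lp_norm p M \<eta>"
proof (rule field_le_epsilon)
  fix e :: real assume e: "0 < e"
  obtain f where f: "f \<in> Lp_fun p M" "\<xi> = Lp_class p M f" using assms(2) by (rule LpE)
  obtain g where g: "g \<in> Lp_fun p M" "\<eta> = Lp_class p M g" using assms(3) by (rule LpE)
  \<comment> \<open>The surplus \<open>e / 2\<close> keeps the divisors positive when a norm
    vanishes.\<close>
  define \<alpha> where "\<alpha> = Lp_norm p M \<xi> + e / 2"
  define \<beta> where "\<beta> = Lp_norm p M \<eta> + e / 2"
  have pos: "\<alpha> > 0" "\<beta> > 0" "Lp_norm p M \<xi> \<le> \<alpha>" "Lp_norm p M \<eta> \<le> \<beta>"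
    using e Lp_norm_nonneg[of p M \<xi>] Lp_norm_nonneg[of p M \<eta>] by (auto simp: \<alpha>_def \<beta>_def)
  have n1: "Lp_norm p M (Lp_scale p M (of_real (1 / \<alpha>)) \<xi>) \<le> 1"
    "Lp_norm p M (Lp_scale p M (of_real (1 / \<beta>)) \<eta>) \<le> 1"
    using pos assms by (simp_all add: Lp_norm_scale norm_divide del: of_real_divide)
  have "Lp_norm p M (Lp_plus p M (Lp_scale p M (of_real (\<alpha> / (\<alpha> + \<beta>))) (Lp_scale p M (of_real (1 / \<alpha>)) \<xi>))
      (Lp_scale p M (of_real (\<beta> / (\<alpha> + \<beta>))) (Lp_scale p M (of_real (1 / \<beta>)) \<eta>))) \<le> 1"
    by (rule Lp_norm_convex[OF assms(1) Lp_scale_in_Lp[OF assms(2)] Lp_scale_in_Lp[OF assms(3)] _ _ _ n1])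
      (use pos in \<open>auto simp: add_divide_distrib[symmetric]\<close>)
  also have "Lp_plus p M (Lp_scale p M (of_real (\<alpha> / (\<alpha> + \<beta>))) (Lp_scale p M (of_real (1 / \<alpha>)) \<xi>))
      (Lp_scale p M (of_real (\<beta> / (\<alpha> + \<beta>))) (Lp_scale p M (of_real (1 / \<beta>)) \<eta>))
    = Lp_scale p M (of_real (1 / (\<alpha> + \<beta>))) (Lp_plus p M \<xi> \<eta>)"
  proof -
    have "of_real (\<alpha> / (\<alpha> + \<beta>)) * (of_real (1 / \<alpha>) * z) = of_real (1 / (\<alpha> + \<beta>)) * z"
      "of_real (\<beta> / (\<alpha> + \<beta>)) * (of_real (1 / \<beta>) * z) = of_real (1 / (\<alpha> + \<beta>)) * z" for z :: complex
      unfolding mult.assoc[symmetric] of_real_mult[symmetric] using pos by simp_all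
    then show ?thesis
      using f g assms(1)
      by (simp only: Lp_scale_Lp_class Lp_plus_Lp_class Lp_fun_scale Lp_fun_add distrib_left)
  qed
  finally have "cmod (of_real (1 / (\<alpha> + \<beta>))) * Lp_norm p M (Lp_plus p M \<xi> \<eta>) \<le> 1"
    using assms by (simp add: Lp_norm_scale Lp_plus_in_Lp)
  then have "Lp_norm p M (Lp_plus p M \<xi> \<eta>) / (\<alpha> + \<beta>) \<le> 1"
    using pos by (simp only: norm_of_real) simp
  then show "Lp_norm p M (Lp_plus p M \<xi> \<eta>) \<le> Lp_norm p M \<xi> + Lp_norm p M \<eta> + e"
    using pos by (simp add: divide_le_eq \<alpha>_def \<beta>_def)
qed

text \<open>The pointwise inequality integrates to an estimate for p-th powers of norms, and
  Bernoulli's inequality brings it back to the norms. The number \<open>h\<close> is chosen before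
  the vectors, hence is uniform.\<close>

lemma Lp_norm_smooth:
  assumes "1 < p" "0 < \<epsilon>"
  shows "\<exists>h>0. \<forall>\<xi>\<in>Lp p M. \<forall>\<eta>\<in>Lp p M. Lp_norm p M \<xi> \<le> 1 \<longrightarrow> Lp_norm p M \<eta> \<le> 1 \<longrightarrow>
    Lp_norm p M (Lp_plus p M \<xi> (Lp_scale p M (of_real h) \<eta>))
      + Lp_norm p M (Lp_plus p M \<xi> (Lp_scale p M (- of_real h) \<eta>)) \<le> 2 + \<epsilon> * h"
proof -
  \<comment> \<open>One factor 2 is lost because two p-th powers of norms are added, another because
    the pointwise estimate concerns the average.\<close>
  have "0 < \<epsilon> / 4" using assms by simp
  from cmod_smooth[OF assms(1) this] obtain h where h: "h > 0"
    and hst: "\<And>s t :: complex. (cmod (s + of_real h * t) powr p + cmod (s - of_real h * t) powr p) / 2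
           \<le> cmod s powr p + \<epsilon> / 4 * h * (cmod s powr p + cmod t powr p)"
    by blast
  have "Lp_norm p M (Lp_plus p M \<xi> (Lp_scale p M (of_real h) \<eta>))
      + Lp_norm p M (Lp_plus p M \<xi> (Lp_scale p M (- of_real h) \<eta>)) \<le> 2 + \<epsilon> * h"
    if \<xi>: "\<xi> \<in> Lp p M" and \<eta>: "\<eta> \<in> Lp p M" and n: "Lp_norm p M \<xi> \<le> 1" "Lp_norm p M \<eta> \<le> 1" for \<xi> \<eta>
  proof -
    obtain f where f: "f \<in> Lp_fun p M" "\<xi> = Lp_class p M f" using \<xi> by (rule LpE)
    obtain g where g: "g \<in> Lp_fun p M" "\<eta> = Lp_class p M g" using \<eta> by (rule LpE)
    define u where "u = (\<lambda>x. f x + of_real h * g x)"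
    define w where "w = (\<lambda>x. f x + - of_real h * g x)"
    have uw: "u \<in> Lp_fun p M" "w \<in> Lp_fun p M"
      unfolding u_def w_def using f g assms by (intro Lp_fun_add Lp_fun_scale; simp)+
    have fg: "(\<integral>x. cmod (f x) powr p \<partial>M) \<le> 1" "(\<integral>x. cmod (g x) powr p \<partial>M) \<le> 1"
      using assms f g n le_one_iff_powr_le_one[OF _ Lp_norm_nonneg, of p p M]
      by (auto simp: Lp_norm_powr)
    note int = Lp_fun_integrable[OF f(1)] Lp_fun_integrable[OF g(1)]
      Lp_fun_integrable[OF uw(1)] Lp_fun_integrable[OF uw(2)]
    have "(\<integral>x. (cmod (u x) powr p + cmod (w x) powr p) / 2 \<partial>M)
        \<le> (\<integral>x. cmod (f x) powr p + \<epsilon> / 4 * h * (cmod (f x) powr p + cmod (g x) powr p) \<partial>M)"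
      by (rule integral_mono)
        (use int hst in \<open>simp_all add: u_def w_def\<close>)
    then have "((\<integral>x. cmod (u x) powr p \<partial>M) + (\<integral>x. cmod (w x) powr p \<partial>M)) / 2
        \<le> (\<integral>x. cmod (f x) powr p \<partial>M) + \<epsilon> / 4 * h * ((\<integral>x. cmod (f x) powr p \<partial>M) + (\<integral>x. cmod (g x) powr p \<partial>M))"
      using int by simp
    also have "\<dots> \<le> 1 + \<epsilon> / 4 * h * (1 + 1)"
      using fg h assms by (intro add_mono mult_left_mono) auto
    finally have sum: "(\<integral>x. cmod (u x) powr p \<partial>M) + (\<integral>x. cmod (w x) powr p \<partial>M) \<le> 2 + \<epsilon> * h"
      by (simp add: field_simps)
    \<comment> \<open>Bernoulli is the tangent at 1. It bounds \<open>p\<close> times the excess of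
      the sum of norms over 2, and the factor \<open>p > 1\<close> can then be dropped.\<close>
    have bern: "1 + p * (x - 1) \<le> x powr p" if "0 \<le> x" for x
      using powr_above_tangent[of p 1 x] that assms by simp
    have *: "p * (Lp_norm p M (Lp_class p M u) + Lp_norm p M (Lp_class p M w) - 2) \<le> \<epsilon> * h"
      using bern[OF Lp_norm_nonneg, of p M "Lp_class p M u"] bern[OF Lp_norm_nonneg, of p M "Lp_class p M w"]
        sum assms uw by (simp add: Lp_norm_powr algebra_simps)
    have le: "x \<le> y" if "p * x \<le> y" "0 \<le> y" for x y
    proof (cases "x \<le> 0")
      case False
      then have "1 * x \<le> p * x" using assms by (intro mult_right_mono) auto
      then show ?thesis using that by simp
    qed (use that in simp)
    have "Lp_norm p M (Lp_class p M u) + Lp_norm p M (Lp_class p M w) - 2 \<le> \<epsilon> * h"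
      by (rule le[OF *]) (use h assms in simp)
    moreover have "Lp_plus p M \<xi> (Lp_scale p M (of_real h) \<eta>) = Lp_class p M u"
      "Lp_plus p M \<xi> (Lp_scale p M (- of_real h) \<eta>) = Lp_class p M w"
      using f g by (simp_all only: Lp_scale_Lp_class Lp_plus_Lp_class Lp_fun_scale u_def w_def)
    ultimately show ?thesis by simp
  qed
  then show ?thesis using h by blast
qed

section \<open>From operators on L^p to the abstract algebra\<close>

lemma Lp_op_norm_bound:
  assumes "0 < p" "T \<in> Lp_bounded_ops p M" "\<xi> \<in> Lp p M"
  shows "Lp_norm p M (T \<xi>) \<le> Lp_op_norm p M T * Lp_norm p M \<xi>"
proof -
  obtain K where K: "\<And>\<xi>. \<xi> \<in> Lp p M \<Longrightarrow> Lp_norm p M (T \<xi>) \<le> K * Lp_norm p M \<xi>"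
    using assms(2) unfolding Lp_bounded_ops_def by blast
  have bdd: "bdd_above ((\<lambda>\<xi>. Lp_norm p M (T \<xi>)) ` {\<xi> \<in> Lp p M. Lp_norm p M \<xi> \<le> 1})"
  proof (rule bdd_aboveI2)
    fix \<eta> assume \<eta>: "\<eta> \<in> {\<xi> \<in> Lp p M. Lp_norm p M \<xi> \<le> 1}"
    have "Lp_norm p M (T \<eta>) \<le> K * Lp_norm p M \<eta>" using K \<eta> by simp
    also have "\<dots> \<le> \<bar>K\<bar> * 1"
      using \<eta> Lp_norm_nonneg[of p M \<eta>] by (intro mult_mono) auto
    finally show "Lp_norm p M (T \<eta>) \<le> \<bar>K\<bar>" by simp
  qed
  show ?thesis
  proof (cases "Lp_norm p M \<xi> = 0")
    \<comment> \<open>A vector of norm zero cannot be normalised; the constant \<open>K\<close>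
      shows that its image has norm zero too.\<close>
    case True
    then show ?thesis using K[OF assms(3)] by simp
  next
    case False
    define r where "r = Lp_norm p M \<xi>"
    have r: "r > 0" using False Lp_norm_nonneg[of p M \<xi>] by (simp add: r_def)
    define \<eta> where "\<eta> = Lp_scale p M (of_real (1 / r)) \<xi>"
    have T\<xi>: "T \<xi> \<in> Lp p M" using assms by (auto simp: Lp_bounded_ops_def)
    have \<eta>: "\<eta> \<in> Lp p M" "Lp_norm p M \<eta> \<le> 1"
      using assms r by (auto simp: \<eta>_def Lp_scale_in_Lp Lp_norm_scale norm_divide r_def)
    have "T \<eta> = Lp_scale p M (of_real (1 / r)) (T \<xi>)"
      using assms by (auto simp: Lp_bounded_ops_def \<eta>_def)
    then have "Lp_norm p M (T \<xi>) / r = Lp_norm p M (T \<eta>)"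
      using r assms T\<xi> by (simp add: Lp_norm_scale norm_divide)
    also have "\<dots> \<le> Lp_op_norm p M T"
      unfolding Lp_op_norm_def using \<eta> bdd by (intro cSUP_upper) auto
    finally show ?thesis using r by (simp add: r_def divide_le_eq)
  qed
qed

text \<open>\<open>V\<close> consists of the seminorms sending \<open>a\<close> to the norm of
  \<open>\<pi> a \<xi>\<close>, with \<xi> in the unit ball, and the algebra norm is their supremum.
  Smoothness is stated for each seminorm with a common \<open>h\<close>: its two terms must be taken
  at the same \<xi>, whereas two operator norms may be approached at different vectors.\<close>

lemma Lp_operator_algebra_seminorms:
  fixes M :: "'x measure"
  assumes "1 < p" "Lp_operator_algebra p M TYPE('a::complex_banach_algebra)"
  obtains V :: "('a::complex_banach_algebra \<Rightarrow> real) set" where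
    "\<And>v a b. v \<in> V \<Longrightarrow> v (a + b) \<le> v a + v b"
    "\<And>v c a. v \<in> V \<Longrightarrow> v (c *\<^sub>C a) = cmod c * v a"
    "\<And>v a b. v \<in> V \<Longrightarrow> v (a * b) \<le> norm a * v b"
    "\<And>v a. v \<in> V \<Longrightarrow> v a \<le> norm a"
    "\<And>a B. (\<And>v. v \<in> V \<Longrightarrow> v a \<le> B) \<Longrightarrow> norm a \<le> B"
    "\<And>\<epsilon>. 0 < \<epsilon> \<Longrightarrow> \<exists>h>0. \<forall>v\<in>V. \<forall>a b. v a \<le> 1 \<longrightarrow> v b \<le> 1 \<longrightarrow>
       v (a + of_real h *\<^sub>C b) + v (a + (- of_real h) *\<^sub>C b) \<le> 2 + \<epsilon> * h"
proof -
  from assms(2) obtain B and \<pi> :: "'a \<Rightarrow> 'x Lp_op" where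
    B: "Lp_closed_subalgebra p M B" and bij: "bij_betw \<pi> UNIV B"
    and add: "\<And>a b. \<pi> (a + b) = Lp_op_plus p M (\<pi> a) (\<pi> b)"
    and scale: "\<And>c a. \<pi> (c *\<^sub>C a) = Lp_op_scale p M c (\<pi> a)"
    and mult: "\<And>a b. \<pi> (a * b) = Lp_op_mult p M (\<pi> a) (\<pi> b)"
    and norm: "\<And>a. Lp_op_norm p M (\<pi> a) = norm a"
    unfolding Lp_operator_algebra_def by blast
  define U where "U = {\<xi> \<in> Lp p M. Lp_norm p M \<xi> \<le> 1}"
  define V where "V = (\<lambda>\<xi> a. Lp_norm p M (\<pi> a \<xi>)) ` U"
  have bo: "\<pi> a \<in> Lp_bounded_ops p M" for a
    using B bij by (auto simp: Lp_closed_subalgebra_def bij_betw_def)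
  have in_Lp: "\<pi> a \<xi> \<in> Lp p M" if "\<xi> \<in> Lp p M" for a \<xi>
    using bo[of a] that by (auto simp: Lp_bounded_ops_def)
  have add': "\<pi> (a + b) \<xi> = Lp_plus p M (\<pi> a \<xi>) (\<pi> b \<xi>)" if "\<xi> \<in> Lp p M" for a b \<xi>
    using that by (simp add: add Lp_op_plus_def)
  have scale': "\<pi> (c *\<^sub>C a) \<xi> = Lp_scale p M c (\<pi> a \<xi>)" if "\<xi> \<in> Lp p M" for c a \<xi>
    using that by (simp add: scale Lp_op_scale_def)
  have mult': "\<pi> (a * b) \<xi> = \<pi> a (\<pi> b \<xi>)" if "\<xi> \<in> Lp p M" for a b \<xi>
    using that by (simp add: mult Lp_op_mult_def compose_def)
  have bound: "Lp_norm p M (\<pi> a \<xi>) \<le> norm a * Lp_norm p M \<xi>" if "\<xi> \<in> Lp p M" for a \<xi>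
    using Lp_op_norm_bound[OF _ bo that, of a] assms(1) by (simp add: norm)
  show thesis
  proof (rule that)
    fix v a b assume "v \<in> V"
    then show "v (a + b) \<le> v a + v b"
      using assms(1) by (auto simp: V_def U_def add' in_Lp intro!: Lp_norm_plus_le)
  next
    fix v c a assume "v \<in> V"
    then show "v (c *\<^sub>C a) = cmod c * v a"
      using assms(1) by (auto simp: V_def U_def scale' in_Lp Lp_norm_scale)
  next
    fix v a b assume "v \<in> V"
    then show "v (a * b) \<le> norm a * v b"
      by (auto simp: V_def U_def mult' in_Lp intro!: bound)
  next
    fix v a assume "v \<in> V"
    then obtain \<xi> where \<xi>: "v = (\<lambda>a. Lp_norm p M (\<pi> a \<xi>))" "\<xi> \<in> Lp p M" "Lp_norm p M \<xi> \<le> 1"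
      by (auto simp: V_def U_def)
    have "v a \<le> norm a * Lp_norm p M \<xi>" using bound \<xi> by simp
    also have "\<dots> \<le> norm a" using \<xi> by (simp add: mult_left_le)
    finally show "v a \<le> norm a" .
  next
    fix a :: 'a and C assume C: "\<And>v. v \<in> V \<Longrightarrow> v a \<le> C"
    \<comment> \<open>The zero class shows that the supremum is over a nonempty set.\<close>
    have "Lp_class p M (\<lambda>x. 0) \<in> U"
      using assms(1) by (auto simp: U_def Lp_def Lp_fun_zero Lp_norm_Lp_class)
    then have "Lp_op_norm p M (\<pi> a) \<le> C"
      unfolding Lp_op_norm_def U_def[symmetric] using C by (intro cSUP_least) (auto simp: V_def)
    then show "norm a \<le> C" by (simp add: norm)
  next
    fix \<epsilon> :: real assume "0 < \<epsilon>"
    from Lp_norm_smooth[OF assms(1) this, of M] obtain h where "h > 0" and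
      h: "\<And>\<xi> \<eta>. \<xi> \<in> Lp p M \<Longrightarrow> \<eta> \<in> Lp p M \<Longrightarrow> Lp_norm p M \<xi> \<le> 1 \<Longrightarrow> Lp_norm p M \<eta> \<le> 1 \<Longrightarrow>
        Lp_norm p M (Lp_plus p M \<xi> (Lp_scale p M (of_real h) \<eta>))
        + Lp_norm p M (Lp_plus p M \<xi> (Lp_scale p M (- of_real h) \<eta>)) \<le> 2 + \<epsilon> * h"
      by blast
    then show "\<exists>h>0. \<forall>v\<in>V. \<forall>a b. v a \<le> 1 \<longrightarrow> v b \<le> 1 \<longrightarrow>
       v (a + of_real h *\<^sub>C b) + v (a + (- of_real h) *\<^sub>C b) \<le> 2 + \<epsilon> * h"
      by (intro exI[of _ h]) (auto simp: V_def U_def add' scale' in_Lp)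
  qed
qed


section \<open>Smoothness in the direction of approximate units\<close>

lemma complex_scaleC_one: "1 *\<^sub>C (a::'a::complex_banach_algebra) = a"
  using scaleR_eq_scaleC[of 1 a] by simp

lemma scaleC_minus_left: "(- c) *\<^sub>C (a::'a::complex_banach_algebra) = - (c *\<^sub>C a)"
proof -
  have "c *\<^sub>C a + (- c) *\<^sub>C a = 0"
    using scaleR_eq_scaleC[of 0 a] by (simp flip: scaleC_add_left)
  then show ?thesis by (simp add: add_eq_0_iff)
qed

lemma scaleC_zero_right: "c *\<^sub>C (0::'a::complex_banach_algebra) = 0"
  using scaleC_add_right[of c 0 "0::'a"] by simp

lemma scaleC_diff_right: "c *\<^sub>C (a - b) = c *\<^sub>C a - c *\<^sub>C (b::'a::complex_banach_algebra)"
  using scaleC_add_right[of c "a - b" b] by simp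

text \<open>A form of uniform smoothness in which the direction of the perturbation is
  annihilated by the approximate left unit \<open>e\<close> of \<open>a\<close>.\<close>

definition left_smooth :: "'a::complex_banach_algebra itself \<Rightarrow> bool" where
  "left_smooth _ \<longleftrightarrow> (\<forall>\<epsilon>>0. \<exists>h>0. \<forall>a b e :: 'a. norm a \<le> 1 \<longrightarrow> norm b \<le> 1 \<longrightarrow> norm e \<le> 1 \<longrightarrow>
    norm (a + h *\<^sub>R (b - e * b)) \<le> 1 + \<epsilon> * h + norm (e * a - a))"

text \<open>For x = a + k b and y = a - k b, the sum of x, e y and a - e a is twice a + (k/2)(b - e
  b). Since \<open>e\<close> is a contraction, e y costs no more than y, and smoothness bounds the
  costs of x and y together.\<close>

lemma Lp_operator_algebra_left_smooth:
  fixes M :: "'x measure"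
  assumes "1 < p" "Lp_operator_algebra p M TYPE('a::complex_banach_algebra)"
  shows "left_smooth TYPE('a)"
  unfolding left_smooth_def
proof (intro allI impI, rule Lp_operator_algebra_seminorms[OF assms])
  fix \<epsilon> :: real assume \<epsilon>: "0 < \<epsilon>"
  fix V :: "('a \<Rightarrow> real) set"
  assume V:
    "\<And>v a b. v \<in> V \<Longrightarrow> v (a + b) \<le> v a + v b"
    "\<And>v c a. v \<in> V \<Longrightarrow> v (c *\<^sub>C a) = cmod c * v a"
    "\<And>v a b. v \<in> V \<Longrightarrow> v (a * b) \<le> norm a * v b"
    "\<And>v a. v \<in> V \<Longrightarrow> v a \<le> norm a"
    "\<And>a B. (\<And>v. v \<in> V \<Longrightarrow> v a \<le> B) \<Longrightarrow> norm a \<le> B"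
    "\<And>\<epsilon>. 0 < \<epsilon> \<Longrightarrow> \<exists>h>0. \<forall>v\<in>V. \<forall>a b. v a \<le> 1 \<longrightarrow> v b \<le> 1 \<longrightarrow>
       v (a + of_real h *\<^sub>C b) + v (a + (- of_real h) *\<^sub>C b) \<le> 2 + \<epsilon> * h"
  obtain k where k: "k > 0" and k_smooth: "\<And>v a b. v \<in> V \<Longrightarrow> v a \<le> 1 \<Longrightarrow> v b \<le> 1 \<Longrightarrow>
       v (a + of_real k *\<^sub>C b) + v (a + (- of_real k) *\<^sub>C b) \<le> 2 + \<epsilon> * k"
    using V(6)[OF \<epsilon>] by blast
  define h where "h = k / 2"
  have h: "h > 0" using k by (simp add: h_def)
  have "norm (a + h *\<^sub>R (b - e * b)) \<le> 1 + \<epsilon> * h + norm (e * a - a)"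
    if n: "norm a \<le> 1" "norm b \<le> 1" "norm e \<le> 1" for a b e :: 'a
  proof (rule V(5))
    fix v assume v: "v \<in> V"
    define x where "x = a + of_real k *\<^sub>C b"
    define y where "y = a + (- of_real k) *\<^sub>C b"
    have xy: "x = a + k *\<^sub>R b" "y = a - k *\<^sub>R b"
      by (simp_all add: x_def y_def scaleR_eq_scaleC scaleC_minus_left)
    have "v a \<le> 1" "v b \<le> 1" using V(4)[OF v] n by (meson order_trans)+
    from k_smooth[OF v this] have sum: "v x + v y \<le> 2 + \<epsilon> * k" by (simp add: x_def y_def)
    \<comment> \<open>Nonnegativity comes from the seminorm laws: 0 = v 0 is at most v y + v (- y) =
      2 v y.\<close>
    have vy: "0 \<le> v y"
    proof -
      have "v 0 = 0" using V(2)[OF v, of 0 0] scaleR_eq_scaleC[of 0 "0::'a"] by simp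
      moreover have "v (- y) = v y"
        using V(2)[OF v, of "-1" y] by (simp add: scaleC_minus_left complex_scaleC_one)
      ultimately show ?thesis using V(1)[OF v, of y "- y"] by simp
    qed
    have "v (a - e * a) \<le> norm (e * a - a)"
      using V(4)[OF v, of "a - e * a"] by (simp add: norm_minus_commute)
    moreover have "v (e * y) \<le> v y"
      using V(3)[OF v, of e y] n(3) vy by (meson mult_left_le_one_le norm_ge_zero order_trans)
    moreover have "x + (e * y + (a - e * a)) = 2 *\<^sub>R (a + h *\<^sub>R (b - e * b))"
      by (simp add: xy h_def algebra_simps scaleR_2)
    moreover have "v (2 *\<^sub>R (a + h *\<^sub>R (b - e * b))) = 2 * v (a + h *\<^sub>R (b - e * b))"
      unfolding scaleR_eq_scaleC[of 2] by (simp add: V(2)[OF v])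
    ultimately have "2 * v (a + h *\<^sub>R (b - e * b)) \<le> v x + (v y + norm (e * a - a))"
      using V(1)[OF v, of x "e * y + (a - e * a)"] V(1)[OF v, of "e * y" "a - e * a"] by simp
    also have "\<dots> \<le> 2 + \<epsilon> * k + norm (e * a - a)" using sum by simp
    also have "\<dots> \<le> 2 * (1 + \<epsilon> * h + norm (e * a - a))" by (simp add: h_def)
    finally show "v (a + h *\<^sub>R (b - e * b)) \<le> 1 + \<epsilon> * h + norm (e * a - a)" by simp
  qed
  then show "\<exists>h>0. \<forall>a b e :: 'a. norm a \<le> 1 \<longrightarrow> norm b \<le> 1 \<longrightarrow> norm e \<le> 1 \<longrightarrow>
      norm (a + h *\<^sub>R (b - e * b)) \<le> 1 + \<epsilon> * h + norm (e * a - a)"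
    using h by blast
qed


section \<open>Functionals along contractive approximate identities\<close>

text \<open>Used to make values of functionals real and nonnegative, so that two contributions add
  without cancellation.\<close>

lemma exists_rotation:
  obtains \<theta> :: complex where "cmod \<theta> = 1" "\<theta> * z = of_real (cmod z)"
proof (cases "z = 0")
  case True
  then show thesis using that[of 1] by simp
next
  case False
  show thesis
  proof (rule that[of "cnj z / of_real (cmod z)"])
    show "cmod (cnj z / of_real (cmod z)) = 1"
      using False by (simp add: norm_divide)
    show "cnj z / of_real (cmod z) * z = of_real (cmod z)"
      using False complex_norm_square[of z] by (simp add: field_simps power2_eq_square)
  qed
qed

section \<open>Tails of nets as filters, and approximate identities along them\<close>

lemma eventually_tails:
  assumes "directed_set \<Lambda> r"
  shows "eventually P (tails \<Lambda> r) \<longleftrightarrow> (\<exists>s\<in>\<Lambda>. \<forall>t\<in>\<Lambda>. r s t \<longrightarrow> P t)"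
proof -
  have "eventually P (tails \<Lambda> r) \<longleftrightarrow> (\<exists>s\<in>\<Lambda>. eventually P (principal {t \<in> \<Lambda>. r s t}))"
    unfolding tails_def
  \<comment> \<open>Directedness makes the tails a filter base, so a single tail decides each
    eventual property.\<close>
  proof (rule eventually_INF_base)
    fix s t assume "s \<in> \<Lambda>" "t \<in> \<Lambda>"
    then obtain u where u: "u \<in> \<Lambda>" "r s u" "r t u"
      using assms unfolding directed_set_def by blast
    have "{x \<in> \<Lambda>. r u x} \<subseteq> {x \<in> \<Lambda>. r s x} \<inter> {x \<in> \<Lambda>. r t x}"
      using assms u \<open>s \<in> \<Lambda>\<close> \<open>t \<in> \<Lambda>\<close> unfolding directed_set_def by blast
    then show "\<exists>x\<in>\<Lambda>. principal {t \<in> \<Lambda>. r x t} \<le> inf (principal {t \<in> \<Lambda>. r s t}) (principal {x \<in> \<Lambda>. r t x})"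
      using u(1) by auto
  qed (use assms in \<open>simp add: directed_set_def\<close>)
  then show ?thesis by (auto simp: eventually_principal)
qed

lemma tails_neq_bot:
  assumes "directed_set \<Lambda> r"
  shows "tails \<Lambda> r \<noteq> bot"
  using assms unfolding trivial_limit_def eventually_tails[OF assms] directed_set_def by blast

lemma cai_tails_neq_bot: "cai \<Lambda> r e \<Longrightarrow> tails \<Lambda> r \<noteq> bot"
  by (simp add: cai_def tails_neq_bot)

lemma cai_eventually_norm_le:
  assumes "cai \<Lambda> r e"
  shows "\<forall>\<^sub>F t in tails \<Lambda> r. norm (e t) \<le> 1"
proof -
  have dir: "directed_set \<Lambda> r" using assms by (simp add: cai_def)
  then obtain s where "s \<in> \<Lambda>" unfolding directed_set_def by blast
  then show ?thesis
    using assms unfolding eventually_tails[OF dir] cai_def by blast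
qed

lemma cai_eventually_left:
  assumes "cai \<Lambda> r e" "0 < \<delta>"
  shows "\<forall>\<^sub>F t in tails \<Lambda> r. norm (e t * a - a) < \<delta>"
proof -
  have "((\<lambda>t. e t * a) \<longlongrightarrow> a) (tails \<Lambda> r)" using assms by (simp add: cai_def)
  then show ?thesis using assms(2) by (auto simp: tendsto_iff dist_norm)
qed

section \<open>Elementary norm estimates in the dual\<close>

lemma dual_add: "f \<in> dual \<Longrightarrow> f (x + y) = f x + f y"
  unfolding dual_def bounded_functional_def by blast

lemma dual_scaleC: "f \<in> dual \<Longrightarrow> f (c *\<^sub>C x) = c * f x"
  unfolding dual_def bounded_functional_def by blast

lemma dual_bounded_linear: "f \<in> dual \<Longrightarrow> bounded_linear f"
proof -
  assume f: "f \<in> dual"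
  then obtain K where "\<forall>x. cmod (f x) \<le> K * norm x"
    by (auto simp: dual_def bounded_functional_def)
  with f show ?thesis
    by (intro bounded_linear_intro[of f K])
      (auto simp: dual_add[OF f] dual_scaleC[OF f] scaleR_eq_scaleC scaleR_conv_of_real mult.commute)
qed

lemmas dual_diff = linear_diff[OF bounded_linear.linear[OF dual_bounded_linear]]
lemmas dual_zero = linear_0[OF bounded_linear.linear[OF dual_bounded_linear]]
lemmas dual_tendsto = bounded_linear.tendsto[OF dual_bounded_linear]

lemma dual_bdd_above:
  assumes "f \<in> dual"
  shows "bdd_above ((\<lambda>x. cmod (f x)) ` {x. norm x \<le> 1})"
proof -
  obtain K where K: "\<And>x. cmod (f x) \<le> K * norm x"
    using assms by (auto simp: dual_def bounded_functional_def)
  have "cmod (f x) \<le> \<bar>K\<bar>" if "norm x \<le> 1" for x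
  proof -
    have "K * norm x \<le> \<bar>K\<bar> * 1" using that by (intro mult_mono) auto
    then show ?thesis using K[of x] by simp
  qed
  then show ?thesis by (intro bdd_aboveI2[where M = "\<bar>K\<bar>"]) auto
qed

lemma dual_norm_upper:
  assumes "f \<in> dual" "norm x \<le> 1"
  shows "cmod (f x) \<le> dual_norm f"
  unfolding functional_norm_def using assms by (intro cSUP_upper dual_bdd_above) auto

lemma dual_norm_nonneg: "f \<in> dual \<Longrightarrow> 0 \<le> dual_norm f"
  by (rule order_trans[OF norm_ge_zero dual_norm_upper[of f 0]]) simp_all

lemma dual_norm_bound:
  assumes "f \<in> dual"
  shows "cmod (f x) \<le> dual_norm f * norm x"
proof (cases "x = 0")
  case True
  then show ?thesis using dual_zero[OF assms] by simp
next
  case False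
  have "cmod (f (of_real (1 / norm x) *\<^sub>C x)) \<le> dual_norm f"
    using False by (intro dual_norm_upper[OF assms]) (simp add: norm_scaleC norm_divide)
  then show ?thesis
    using False by (simp add: dual_scaleC[OF assms] norm_mult norm_divide field_simps)
qed

lemma dual_norm_least:
  fixes f :: "'a::complex_banach_algebra \<Rightarrow> complex"
  assumes "\<And>x. norm x \<le> 1 \<Longrightarrow> cmod (f x) \<le> C"
  shows "dual_norm f \<le> C"
  unfolding functional_norm_def
proof (rule cSUP_least)
  show "{x :: 'a. norm x \<le> 1} \<noteq> {}" by (metis empty_Collect_eq norm_zero zero_le_one)
qed (use assms in simp)

lemma dual_norm_almost_attained:
  assumes "f \<in> dual" "c < dual_norm f"
  obtains a s where "norm a \<le> 1" "f a = of_real s" "c < s"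
proof -
  have "\<exists>x\<in>{x. norm x \<le> 1}. c < cmod (f x)"
    using assms(2) less_cSUP_iff[OF _ dual_bdd_above[OF assms(1)]]
    unfolding functional_norm_def by (metis (mono_tags, lifting) empty_iff mem_Collect_eq norm_zero zero_le_one)
  then obtain x where x: "norm x \<le> 1" "c < cmod (f x)" by auto
  obtain \<theta> where "cmod \<theta> = 1" "\<theta> * f x = of_real (cmod (f x))" by (rule exists_rotation)
  with x show thesis
    by (intro that[of "\<theta> *\<^sub>C x" "cmod (f x)"]) (simp_all add: norm_scaleC dual_scaleC[OF assms(1)])
qed

lemma dualI:
  assumes "\<And>x y. f (x + y) = f x + f y" "\<And>c x. f (c *\<^sub>C x) = c * f x"
    "\<And>x. cmod (f x) \<le> K * norm x"
  shows "f \<in> dual"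
  using assms unfolding dual_def bounded_functional_def by blast

lemma dual_add_closed:
  assumes "f \<in> dual" "g \<in> dual"
  shows "(\<lambda>a. f a + g a) \<in> dual"
proof (rule dualI[where K = "dual_norm f + dual_norm g"])
  fix x
  show "cmod (f x + g x) \<le> (dual_norm f + dual_norm g) * norm x"
    using dual_norm_bound[OF assms(1), of x] dual_norm_bound[OF assms(2), of x]
      norm_triangle_ineq[of "f x" "g x"] by (simp add: distrib_right)
qed (simp_all add: dual_add[OF assms(1)] dual_add[OF assms(2)] dual_scaleC[OF assms(1)] dual_scaleC[OF assms(2)] distrib_left)

lemma dual_scale_closed:
  assumes "f \<in> dual"
  shows "(\<lambda>a. c * f a) \<in> dual"
proof (rule dualI[where K = "cmod c * dual_norm f"])
  fix x
  show "cmod (c * f x) \<le> cmod c * dual_norm f * norm x"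
    using mult_left_mono[OF dual_norm_bound[OF assms, of x], of "cmod c"]
    by (simp add: norm_mult mult.assoc)
qed (simp_all add: dual_add[OF assms] dual_scaleC[OF assms] distrib_left)

lemma dual_mult_closed:
  assumes "f \<in> dual"
  shows "(\<lambda>b. f (a * b)) \<in> dual"
proof (rule dualI[where K = "dual_norm f * norm a"])
  fix x
  have "dual_norm f * norm (a * x) \<le> dual_norm f * (norm a * norm x)"
    using assms by (intro mult_left_mono norm_mult_ineq dual_norm_nonneg)
  then show "cmod (f (a * x)) \<le> dual_norm f * norm a * norm x"
    using dual_norm_bound[OF assms, of "a * x"] by (simp add: mult.assoc)
qed (simp_all add: dual_add[OF assms] dual_scaleC[OF assms] distrib_left mult_scaleC_right)

lemma left_smoothE:
  assumes "left_smooth TYPE('a::complex_banach_algebra)" "0 < \<epsilon>"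
  obtains h where "0 < h" "\<And>a b e :: 'a. norm a \<le> 1 \<Longrightarrow> norm b \<le> 1 \<Longrightarrow> norm e \<le> 1 \<Longrightarrow>
    norm (a + h *\<^sub>R (b - e * b)) \<le> 1 + \<epsilon> * h + norm (e * a - a)"
  using assms unfolding left_smooth_def by blast

text \<open>Evaluate \<open>f\<close> at a + h (b - e b), where \<open>f\<close> nearly attains its
  norm at \<open>a\<close> and \<open>b\<close> is rotated. The value is s + h k, while smoothness
  bounds the norm of the argument by 1 + o(h); hence \<open>k\<close> is small. Both
  \<open>h\<close> and \<open>a\<close> are fixed before \<open>b\<close>, which gives uniformity:
  the functionals b \<mapsto> f (e t b) tend to \<open>f\<close> in norm.\<close>

lemma cai_left_uniform_on_dual:
  fixes e :: "'i \<Rightarrow> 'a::complex_banach_algebra"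
  assumes "left_smooth TYPE('a)" "cai \<Lambda> r e" "f \<in> dual" "0 < \<epsilon>"
  shows "\<forall>\<^sub>F t in tails \<Lambda> r. \<forall>b. norm b \<le> 1 \<longrightarrow> cmod (f (b - e t * b)) \<le> \<epsilon>"
proof -
  define n where "n = dual_norm f"
  have n: "0 \<le> n" using assms by (simp add: n_def dual_norm_nonneg)
  \<comment> \<open>The final estimate is
    \<open>h * k \<le> h * (\<delta> * (1 + 2 * n))\<close>.\<close>
  define \<delta> where "\<delta> = \<epsilon> / (1 + 2 * n)"
  have \<delta>: "0 < \<delta>" using n assms by (simp add: \<delta>_def)
  obtain h where h: "0 < h" and sm: "\<And>a b e :: 'a. norm a \<le> 1 \<Longrightarrow> norm b \<le> 1 \<Longrightarrow> norm e \<le> 1 \<Longrightarrow>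
    norm (a + h *\<^sub>R (b - e * b)) \<le> 1 + \<delta> * h + norm (e * a - a)"
    using left_smoothE[OF assms(1) \<delta>] by metis
  have \<delta>h: "0 < \<delta> * h" using \<delta> h by simp
  \<comment> \<open>The norm is attained up to \<open>\<delta> * h\<close>, an error that survives
    the division by \<open>h\<close>.\<close>
  obtain a s where a: "norm a \<le> 1" "f a = of_real s" "n - \<delta> * h < s"
    using dual_norm_almost_attained[OF assms(3), of "n - \<delta> * h"] \<delta>h by (auto simp: n_def)
  show ?thesis
    using cai_eventually_norm_le[OF assms(2)] cai_eventually_left[OF assms(2) \<delta>h, of a]
  proof eventually_elim
    case (elim t)
    show ?case
    proof (intro allI impI)
      fix b :: 'a assume b: "norm b \<le> 1"
      define k where "k = cmod (f (b - e t * b))"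
      obtain \<theta> where \<theta>: "cmod \<theta> = 1" "\<theta> * f (b - e t * b) = of_real k"
        unfolding k_def by (rule exists_rotation)
      have "f (\<theta> *\<^sub>C b - e t * (\<theta> *\<^sub>C b)) = \<theta> * f (b - e t * b)"
        by (simp add: dual_diff[OF assms(3)] dual_scaleC[OF assms(3)] mult_scaleC_right right_diff_distrib)
      then have "f (a + h *\<^sub>R (\<theta> *\<^sub>C b - e t * (\<theta> *\<^sub>C b))) = of_real (s + h * k)"
        by (simp add: dual_add[OF assms(3)] dual_scaleC[OF assms(3)] scaleR_eq_scaleC a \<theta>)
      then have "\<bar>s + h * k\<bar> \<le> n * norm (a + h *\<^sub>R (\<theta> *\<^sub>C b - e t * (\<theta> *\<^sub>C b)))"
        using dual_norm_bound[OF assms(3), of "a + h *\<^sub>R (\<theta> *\<^sub>C b - e t * (\<theta> *\<^sub>C b))"]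
        by (simp only: norm_of_real n_def)
      also have "\<dots> \<le> n * (1 + \<delta> * h + \<delta> * h)"
        using sm[OF a(1), of "\<theta> *\<^sub>C b" "e t"] b elim \<theta> n
        by (intro mult_left_mono) (auto simp: norm_scaleC)
      finally have "h * k \<le> \<delta> * h + n * (\<delta> * h + \<delta> * h)"
        using a(3) by (simp add: algebra_simps)
      also have "\<dots> = h * (\<delta> * (1 + 2 * n))" by (simp add: algebra_simps)
      also have "\<delta> * (1 + 2 * n) = \<epsilon>" using n by (simp add: \<delta>_def)
      finally show "cmod (f (b - e t * b)) \<le> \<epsilon>" using h by (simp add: k_def)
    qed
  qed
qed


section \<open>States\<close>

lemma unitization_norm_upper:
  assumes "norm c \<le> 1"
  shows "norm (a * c + l *\<^sub>C c) \<le> unitization_norm (a, l)"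
proof -
  have "norm (a * c + l *\<^sub>C c) \<le> norm a + cmod l" if "norm c \<le> 1" for c
  proof -
    have "norm a * norm c \<le> norm a" "cmod l * norm c \<le> cmod l"
      using that by (simp_all add: mult_left_le)
    then show ?thesis
      using norm_triangle_ineq[of "a * c" "l *\<^sub>C c"] norm_mult_ineq[of a c] by (simp add: norm_scaleC)
  qed
  then have "bdd_above ((\<lambda>c. norm (a * c + l *\<^sub>C c)) ` {c. norm c \<le> 1})"
    by (intro bdd_aboveI2[where M = "norm a + cmod l"]) auto
  then show ?thesis
    unfolding unitization_norm_def using assms by (auto intro: cSUP_upper)
qed

lemma unitization_norm_least:
  fixes a :: "'a::complex_banach_algebra"
  assumes "\<And>c. norm c \<le> 1 \<Longrightarrow> norm (a * c + l *\<^sub>C c) \<le> C"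
  shows "unitization_norm (a, l) \<le> C"
  unfolding unitization_norm_def
proof (rule cSUP_least)
  show "{c :: 'a. norm c \<le> 1} \<noteq> {}" by (metis empty_Collect_eq norm_zero zero_le_one)
qed (use assms in simp)

lemma unitization_state_add: "unitization_state \<omega> \<Longrightarrow> \<omega> (x + y) = \<omega> x + \<omega> y"
  unfolding unitization_state_def bounded_functional_def by blast

lemma unitization_state_scale: "unitization_state \<omega> \<Longrightarrow> \<omega> (unitization_scale c x) = c * \<omega> x"
  unfolding unitization_state_def bounded_functional_def by blast

text \<open>Scaling by 1/C puts the element in the unit ball, where a functional of norm one is at
  most 1. A positive bound \<open>C\<close> replaces the multiplier norm, so no division by that
  norm occurs.\<close>

lemma unitization_state_bound:
  fixes \<omega> :: "'a::complex_banach_algebra \<times> complex \<Rightarrow> complex"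
  assumes "unitization_state \<omega>" "0 < C"
    and "\<And>c. norm c \<le> 1 \<Longrightarrow> norm (a * c + l *\<^sub>C c) \<le> C"
  shows "cmod (\<omega> (a, l)) \<le> C"
proof -
  obtain K where K: "\<And>x. cmod (\<omega> x) \<le> K * unitization_norm x"
    using assms(1) unfolding unitization_state_def bounded_functional_def by blast
  have nonneg: "0 \<le> unitization_norm x" for x :: "'a \<times> complex"
    using unitization_norm_upper[of 0 "fst x" "snd x"] order_trans[OF norm_ge_zero] by fastforce
  have "cmod (\<omega> x) \<le> \<bar>K\<bar>" if "unitization_norm x \<le> 1" for x
  proof -
    have "K * unitization_norm x \<le> \<bar>K\<bar> * 1" using that nonneg by (intro mult_mono) auto
    then show ?thesis using K[of x] by simp
  qed
  then have bdd: "bdd_above ((\<lambda>x. cmod (\<omega> x)) ` {x. unitization_norm x \<le> 1})"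
    by (intro bdd_aboveI2[where M = "\<bar>K\<bar>"]) auto
  define y where "y = unitization_scale (of_real (1 / C)) (a, l)"
  have "unitization_norm y \<le> 1"
    unfolding y_def unitization_scale_def fst_conv snd_conv
  proof (rule unitization_norm_least)
    fix c :: 'a assume c: "norm c \<le> 1"
    have "(of_real (1 / C) *\<^sub>C a) * c + (of_real (1 / C) * l) *\<^sub>C c = (1 / C) *\<^sub>R (a * c + l *\<^sub>C c)"
      by (simp only: scaleR_eq_scaleC mult_scaleC_left scaleC_add_right scaleC_scaleC)
    then show "norm ((of_real (1 / C) *\<^sub>C a) * c + (of_real (1 / C) * l) *\<^sub>C c) \<le> 1"
      using assms(3)[OF c] assms(2) by (simp add: divide_le_eq)
  qed
  then have "cmod (\<omega> y) \<le> functional_norm unitization_norm \<omega>"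
    unfolding functional_norm_def using bdd by (auto intro: cSUP_upper)
  also have "\<dots> = 1" using assms by (simp add: unitization_state_def)
  finally show ?thesis
    using assms(2) by (simp add: y_def unitization_state_scale[OF assms(1)] norm_mult norm_divide divide_le_eq)
qed

lemma unitization_state_decomp:
  assumes "unitization_state \<omega>" "extends \<omega> \<phi>"
  shows "\<omega> (a, l) = \<phi> a + l"
proof -
  have "(a, l) = (a, 0) + unitization_scale l (0, 1)"
    by (simp add: unitization_scale_def scaleC_zero_right)
  then have "\<omega> (a, l) = \<omega> (a, 0) + l * \<omega> (0, 1)"
    by (metis unitization_state_add[OF assms(1)] unitization_state_scale[OF assms(1)])
  then show ?thesis using assms by (simp add: unitization_state_def extends_def)
qed

text \<open>The argument of \<open>cai_left_uniform_on_dual\<close> with the identity of the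
  unitization in place of \<open>b\<close>. Multiplication by \<open>c\<close> in the unit ball
  brings everything back into the algebra, where smoothness applies to a c and \<theta> c.\<close>

lemma state_tendsto_one:
  fixes e :: "'i \<Rightarrow> 'a::complex_banach_algebra"
  assumes "left_smooth TYPE('a)" "cai \<Lambda> r e" "state \<phi>"
  shows "((\<lambda>t. \<phi> (e t)) \<longlongrightarrow> 1) (tails \<Lambda> r)"
proof (rule tendstoI)
  fix \<epsilon> :: real assume \<epsilon>: "0 < \<epsilon>"
  obtain \<omega> where \<omega>: "unitization_state \<omega>" "extends \<omega> \<phi>"
    and \<phi>: "\<phi> \<in> dual" "dual_norm \<phi> = 1"
    using assms(3) by (auto simp: state_def)
  define \<delta> where "\<delta> = \<epsilon> / 4"
  have \<delta>: "0 < \<delta>" using \<epsilon> by (simp add: \<delta>_def)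
  obtain h where h: "0 < h" and sm: "\<And>a b e :: 'a. norm a \<le> 1 \<Longrightarrow> norm b \<le> 1 \<Longrightarrow> norm e \<le> 1 \<Longrightarrow>
    norm (a + h *\<^sub>R (b - e * b)) \<le> 1 + \<delta> * h + norm (e * a - a)"
    using left_smoothE[OF assms(1) \<delta>] by metis
  have \<delta>h: "0 < \<delta> * h" using \<delta> h by simp
  obtain a s where a: "norm a \<le> 1" "\<phi> a = of_real s" "1 - \<delta> * h < s"
    using dual_norm_almost_attained[OF \<phi>(1), of "1 - \<delta> * h"] \<delta>h \<phi>(2) by auto
  show "\<forall>\<^sub>F t in tails \<Lambda> r. dist (\<phi> (e t)) 1 < \<epsilon>"
    using cai_eventually_norm_le[OF assms(2)] cai_eventually_left[OF assms(2) \<delta>h, of a]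
  proof eventually_elim
    case (elim t)
    define k where "k = cmod (1 - \<phi> (e t))"
    obtain \<theta> where \<theta>: "cmod \<theta> = 1" "\<theta> * (1 - \<phi> (e t)) = of_real k"
      unfolding k_def by (rule exists_rotation)
    define l where "l = of_real h * \<theta>"
    \<comment> \<open>The pair represents a + h \<theta> (1 - e t).\<close>
    have "cmod (\<omega> (a + (- l) *\<^sub>C e t, l)) \<le> 1 + \<delta> * h + \<delta> * h"
    proof (rule unitization_state_bound[OF \<omega>(1)])
      fix c :: 'a assume c: "norm c \<le> 1"
      have "norm (a * c) \<le> 1"
        using norm_mult_ineq[of a c] mult_mono[OF a(1) c] by simp
      moreover have "norm (\<theta> *\<^sub>C c) \<le> 1" using c \<theta> by (simp add: norm_scaleC)
      ultimately have "norm (a * c + h *\<^sub>R (\<theta> *\<^sub>C c - e t * (\<theta> *\<^sub>C c)))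
          \<le> 1 + \<delta> * h + norm (e t * (a * c) - a * c)"
        using elim by (intro sm) auto
      also have "e t * (a * c) - a * c = (e t * a - a) * c"
        by (simp add: algebra_simps)
      also have "norm ((e t * a - a) * c) \<le> \<delta> * h * 1"
        using elim c \<delta>h by (intro order_trans[OF norm_mult_ineq] mult_mono) auto
      also have "a * c + h *\<^sub>R (\<theta> *\<^sub>C c - e t * (\<theta> *\<^sub>C c)) = (a + (- l) *\<^sub>C e t) * c + l *\<^sub>C c"
        by (simp add: l_def scaleC_minus_left scaleC_diff_right left_diff_distrib mult_scaleC_left
            mult_scaleC_right scaleR_eq_scaleC scaleC_scaleC)
      finally show "norm ((a + (- l) *\<^sub>C e t) * c + l *\<^sub>C c) \<le> 1 + \<delta> * h + \<delta> * h" by simp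
    qed (use \<delta>h in simp)
    moreover have "\<omega> (a + (- l) *\<^sub>C e t, l) = of_real (s + h * k)"
    proof -
      have "\<omega> (a + (- l) *\<^sub>C e t, l) = of_real s + of_real h * (\<theta> * (1 - \<phi> (e t)))"
        by (simp add: unitization_state_decomp[OF \<omega>] dual_add[OF \<phi>(1)] dual_scaleC[OF \<phi>(1)] a l_def
            algebra_simps)
      then show ?thesis by (simp add: \<theta>)
    qed
    ultimately have "s + h * k \<le> 1 + \<delta> * h + \<delta> * h"
      by (simp only: norm_of_real)
    then have "h * k \<le> h * (3 * \<delta>)" using a(3) by (simp add: algebra_simps)
    then have "k \<le> 3 * \<delta>" using h by simp
    also have "\<dots> < \<epsilon>" using \<epsilon> by (simp add: \<delta>_def)
    finally show ?case by (simp add: k_def dist_norm norm_minus_commute)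
  qed
qed

text \<open>The only candidate extension is \<phi> a + l. It is the limit of \<phi> applied to (a +
  l 1) (e t), and each of these values is bounded by the multiplier norm because \<phi> and
  \<open>e t\<close> are contractive.\<close>

lemma state_if_tendsto_one:
  fixes e :: "'i \<Rightarrow> 'a::complex_banach_algebra"
  assumes "cai \<Lambda> r e" "\<phi> \<in> dual" "dual_norm \<phi> = 1" "((\<lambda>t. \<phi> (e t)) \<longlongrightarrow> 1) (tails \<Lambda> r)"
  shows "state \<phi>"
proof -
  define \<omega> where "\<omega> = (\<lambda>x :: 'a \<times> complex. \<phi> (fst x) + snd x)"
  have bound: "cmod (\<omega> x) \<le> unitization_norm x" for x
  proof -
    obtain a l where x: "x = (a, l)" by (cases x)
    have "((\<lambda>t. a * e t) \<longlongrightarrow> a) (tails \<Lambda> r)" using assms(1) by (simp add: cai_def)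
    then have "((\<lambda>t. cmod (\<phi> (a * e t) + l * \<phi> (e t))) \<longlongrightarrow> cmod (\<phi> a + l * 1)) (tails \<Lambda> r)"
      by (intro tendsto_norm tendsto_add tendsto_mult tendsto_const dual_tendsto assms)
    moreover have "\<forall>\<^sub>F t in tails \<Lambda> r. cmod (\<phi> (a * e t) + l * \<phi> (e t)) \<le> unitization_norm x"
      using cai_eventually_norm_le[OF assms(1)]
    proof eventually_elim
      case (elim t)
      have "\<phi> (a * e t) + l * \<phi> (e t) = \<phi> (a * e t + l *\<^sub>C e t)"
        by (simp add: dual_add[OF assms(2)] dual_scaleC[OF assms(2)])
      then show ?case
        using dual_norm_bound[OF assms(2), of "a * e t + l *\<^sub>C e t"] assms(3)
          unitization_norm_upper[OF elim, of a l] by (simp add: x)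
    qed
    ultimately have "cmod (\<phi> a + l * 1) \<le> unitization_norm x"
      using cai_tails_neq_bot[OF assms(1)] by (rule tendsto_upperbound)
    then show ?thesis by (simp add: \<omega>_def x)
  qed
  have one: "\<omega> (0, 1) = 1" using dual_zero[OF assms(2)] by (simp add: \<omega>_def)
  \<comment> \<open>The identity lies in the unit ball and has value 1 under \<omega>, so the
    functional norm is at least 1.\<close>
  have N1: "unitization_norm (0 :: 'a, 1) \<le> 1"
    by (rule unitization_norm_least) (simp add: complex_scaleC_one)
  have "functional_norm unitization_norm \<omega> \<le> 1"
    unfolding functional_norm_def using N1 order_trans[OF bound]
    by (intro cSUP_least) (auto simp del: split_paired_Ex split_paired_All)
  moreover have "cmod (\<omega> (0, 1)) \<le> functional_norm unitization_norm \<omega>"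
    unfolding functional_norm_def
  proof (rule cSUP_upper)
    show "bdd_above ((\<lambda>x. cmod (\<omega> x)) ` {x. unitization_norm x \<le> 1})"
      using order_trans[OF bound] by (intro bdd_aboveI2[where M = 1]) simp
  qed (use N1 in simp)
  moreover have "bounded_functional unitization_scale unitization_norm \<omega>"
    unfolding bounded_functional_def
  proof (intro conjI allI exI)
    show "cmod (\<omega> x) \<le> 1 * unitization_norm x" for x using bound by simp
  qed (simp_all add: \<omega>_def unitization_scale_def dual_add[OF assms(2)] dual_scaleC[OF assms(2)] algebra_simps)
  ultimately have "unitization_state \<omega>"
    using one by (simp add: unitization_state_def)
  moreover have "extends \<omega> \<phi>" by (simp add: extends_def \<omega>_def)
  ultimately show ?thesis using assms by (auto simp: state_def)
qed


section \<open>The identity of the bidual\<close>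

text \<open>The uniform estimate at one index \<open>u\<close>, applied to b = e t, puts f (e t)
  near f (e u * e t), which tends to f (e u) by the right approximate identity property. So the net
  of values is Cauchy.\<close>

lemma dual_cai_convergent:
  fixes e :: "'i \<Rightarrow> 'a::complex_banach_algebra"
  assumes "left_smooth TYPE('a)" "cai \<Lambda> r e" "f \<in> dual"
  shows "((\<lambda>t. f (e t)) \<longlongrightarrow> Lim (tails \<Lambda> r) (\<lambda>t. f (e t))) (tails \<Lambda> r)"
proof -
  have "cauchy_filter (filtermap (\<lambda>t. f (e t)) (tails \<Lambda> r))"
    unfolding cauchy_filter_metric_filtermap
  proof (intro allI impI)
    fix \<epsilon> :: real assume \<epsilon>: "0 < \<epsilon>"
    then have "0 < \<epsilon> / 5" by simp
    from cai_left_uniform_on_dual[OF assms this] obtain u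
      where u: "\<And>b. norm b \<le> 1 \<Longrightarrow> cmod (f (b - e u * b)) \<le> \<epsilon> / 5"
      using eventually_happens'[OF cai_tails_neq_bot[OF assms(2)]] by blast
    have "((\<lambda>t. f (e u * e t)) \<longlongrightarrow> f (e u)) (tails \<Lambda> r)"
      using assms(2) by (intro dual_tendsto[OF assms(3)]) (simp add: cai_def)
    then have "\<forall>\<^sub>F t in tails \<Lambda> r. dist (f (e u * e t)) (f (e u)) < \<epsilon> / 5"
      by (rule tendstoD) (use \<epsilon> in simp)
    then have "\<forall>\<^sub>F t in tails \<Lambda> r. dist (f (e t)) (f (e u)) < \<epsilon> / 2"
      using cai_eventually_norm_le[OF assms(2)]
    proof eventually_elim
      case (elim t)
      have "dist (f (e t)) (f (e u * e t)) \<le> \<epsilon> / 5"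
        using u[OF elim(2)] by (simp add: dist_norm dual_diff[OF assms(3)])
      then show ?case
        using elim(1) \<epsilon> dist_triangle[of "f (e t)" "f (e u)" "f (e u * e t)"] by simp
    qed
    moreover have "dist (f (e s)) (f (e t)) < \<epsilon>"
      if "dist (f (e s)) (f (e u)) < \<epsilon> / 2 \<and> dist (f (e t)) (f (e u)) < \<epsilon> / 2" for s t
      using that by (auto intro: dist_triangle_half_l)
    ultimately show "\<exists>P. eventually P (tails \<Lambda> r) \<and> (\<forall>s t. P s \<and> P t \<longrightarrow> dist (f (e s)) (f (e t)) < \<epsilon>)"
      by blast
  qed
  moreover have "filtermap (\<lambda>t. f (e t)) (tails \<Lambda> r) \<noteq> bot"
    using cai_tails_neq_bot[OF assms(2)] by (simp add: filtermap_bot_iff)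
  ultimately obtain L where "filtermap (\<lambda>t. f (e t)) (tails \<Lambda> r) \<le> nhds L"
    using cauchy_filter_complete_converges[of "filtermap (\<lambda>t. f (e t)) (tails \<Lambda> r)" UNIV]
      complete_UNIV by auto
  then have "((\<lambda>t. f (e t)) \<longlongrightarrow> L) (tails \<Lambda> r)" by (simp add: filterlim_def)
  then show ?thesis
    using tendsto_Lim[OF cai_tails_neq_bot[OF assms(2)]] by metis
qed

text \<open>\<open>E\<close> is the weak* limit of the approximate identity. It is a right identity
  because f (a * e t) tends to f a; it is a left identity because the functionals b \<mapsto> f (e t
  * b) tend to \<open>f\<close> in norm, by \<open>cai_left_uniform_on_dual\<close>, and every
  \<open>F\<close> in the bidual is norm continuous.\<close>

lemma bidual_one_eq_Lim:
  fixes e :: "'i \<Rightarrow> 'a::complex_banach_algebra"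
  assumes "left_smooth TYPE('a)" "cai \<Lambda> r e"
  shows "bidual_one = (\<lambda>f\<in>dual. Lim (tails \<Lambda> r) (\<lambda>t. f (e t)))"
proof -
  define E where "E = (\<lambda>f\<in>dual. Lim (tails \<Lambda> r) (\<lambda>t. f (e t)))"
  note nbot = cai_tails_neq_bot[OF assms(2)]
  have lim: "((\<lambda>t. f (e t)) \<longlongrightarrow> E f) (tails \<Lambda> r)" if "f \<in> dual" for f
    using dual_cai_convergent[OF assms that] that by (simp add: E_def)
  have E_eqI: "E f = L" if "f \<in> dual" "((\<lambda>t. f (e t)) \<longlongrightarrow> L) (tails \<Lambda> r)" for f L
    using tendsto_unique[OF nbot lim[OF that(1)] that(2)] .
  have E: "E \<in> bidual"
    unfolding bidual_def mem_Collect_eq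
  proof (intro conjI ballI allI exI)
    show "E \<in> extensional dual" by (simp add: E_def)
    show "E (\<lambda>a. f a + g a) = E f + E g" if "f \<in> dual" "g \<in> dual" for f g
      using that by (intro E_eqI dual_add_closed tendsto_add lim)
    show "E (\<lambda>a. c * f a) = c * E f" if "f \<in> dual" for c f
      using that by (intro E_eqI dual_scale_closed tendsto_mult tendsto_const lim)
    show "cmod (E f) \<le> 1 * dual_norm f" if f: "f \<in> dual" for f
    proof -
      have "\<forall>\<^sub>F t in tails \<Lambda> r. cmod (f (e t)) \<le> dual_norm f"
        using cai_eventually_norm_le[OF assms(2)] by eventually_elim (rule dual_norm_upper[OF f])
      then show ?thesis
        using tendsto_upperbound[OF tendsto_norm[OF lim[OF f]] _ nbot] by simp
    qed
  qed
  have right: "arens F E = F" if F: "F \<in> bidual" for F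
  proof (rule extensionalityI)
    show "arens F E \<in> extensional dual" by (simp add: arens_def)
    show "F \<in> extensional dual" using F by (simp add: bidual_def)
    fix f :: "'a \<Rightarrow> complex" assume f: "f \<in> dual"
    have "E (\<lambda>b. f (a * b)) = f a" for a
      using assms(2) by (intro E_eqI dual_mult_closed[OF f] dual_tendsto[OF f]) (simp add: cai_def)
    then show "arens F E f = F f" using f by (simp add: arens_def)
  qed
  have left: "arens E F = F" if F: "F \<in> bidual" for F
  proof (rule extensionalityI)
    show "arens E F \<in> extensional dual" by (simp add: arens_def)
    show "F \<in> extensional dual" using F by (simp add: bidual_def)
    fix f :: "'a \<Rightarrow> complex" assume f: "f \<in> dual"
    have F_add: "F (\<lambda>a. g a + k a) = F g + F k" if "g \<in> dual" "k \<in> dual" for g k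
      using F that by (simp add: bidual_def)
    have F_scale: "F (\<lambda>a. c * g a) = c * F g" if "g \<in> dual" for c g
      using F that by (simp add: bidual_def)
    obtain K' where K': "\<And>g. g \<in> dual \<Longrightarrow> cmod (F g) \<le> K' * dual_norm g"
      using F unfolding bidual_def by blast
    \<comment> \<open>Adding 1 makes the bound positive, so that \<epsilon> can be divided by
      \<open>2 * K\<close>.\<close>
    define K where "K = \<bar>K'\<bar> + 1"
    have K0: "0 < K" by (simp add: K_def)
    have K: "cmod (F g) \<le> K * dual_norm g" if "g \<in> dual" for g
    proof -
      have "K' * dual_norm g \<le> K * dual_norm g"
        using dual_norm_nonneg[OF that] by (intro mult_right_mono) (auto simp: K_def)
      then show ?thesis using K'[OF that] by simp
    qed
    define G where "G = (\<lambda>a. F (\<lambda>b. f (a * b)))"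
    have G: "G \<in> dual"
    proof (rule dualI[where K = "K * dual_norm f"])
      show "G (x + y) = G x + G y" for x y
        unfolding G_def using F_add[OF dual_mult_closed[OF f] dual_mult_closed[OF f]]
        by (simp add: distrib_right dual_add[OF f])
      show "G (c *\<^sub>C x) = c * G x" for c x
        unfolding G_def using F_scale[OF dual_mult_closed[OF f]]
        by (simp add: mult_scaleC_left dual_scaleC[OF f])
      show "cmod (G x) \<le> K * dual_norm f * norm x" for x
      proof -
        have "dual_norm (\<lambda>b. f (x * b)) \<le> dual_norm f * norm x"
        proof (rule dual_norm_least)
          fix b :: 'a assume "norm b \<le> 1"
          then have "norm (x * b) \<le> norm x"
            using norm_mult_ineq[of x b] mult_left_le[of "norm b" "norm x"] by simp
          then show "cmod (f (x * b)) \<le> dual_norm f * norm x"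
            using dual_norm_bound[OF f, of "x * b"] dual_norm_nonneg[OF f]
            by (meson mult_left_mono order_trans)
        qed
        then have "K * dual_norm (\<lambda>b. f (x * b)) \<le> K * (dual_norm f * norm x)"
          using K0 by simp
        then show ?thesis
          using K[OF dual_mult_closed[OF f], of x] by (simp add: G_def mult.assoc)
      qed
    qed
    have "((\<lambda>t. G (e t)) \<longlongrightarrow> F f) (tails \<Lambda> r)"
    proof (rule tendstoI)
      fix \<epsilon> :: real assume \<epsilon>: "0 < \<epsilon>"
      then have "0 < \<epsilon> / (2 * K)" using K0 by simp
      from cai_left_uniform_on_dual[OF assms f this]
      show "\<forall>\<^sub>F t in tails \<Lambda> r. dist (G (e t)) (F f) < \<epsilon>"
      proof eventually_elim
        case (elim t)
        \<comment> \<open>The difference is written with the factor -1 so that additivity and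
          homogeneity of \<open>F\<close> on \<open>dual\<close> apply directly.\<close>
        define k where "k = (\<lambda>b. f b + (-1) * f (e t * b))"
        have k: "k \<in> dual" unfolding k_def
          by (intro dual_add_closed dual_scale_closed dual_mult_closed f)
        have "F k = F f - G (e t)"
          unfolding k_def
          by (subst F_add[OF f dual_scale_closed[OF dual_mult_closed[OF f]]],
              subst F_scale[OF dual_mult_closed[OF f]]) (simp add: G_def)
        moreover have "dual_norm k \<le> \<epsilon> / (2 * K)"
          by (rule dual_norm_least) (use elim in \<open>simp add: k_def dual_diff[OF f]\<close>)
        then have "K * dual_norm k \<le> K * (\<epsilon> / (2 * K))"
          using K0 by (intro mult_left_mono) auto
        then have "cmod (F k) \<le> \<epsilon> / 2" using K[OF k] K0 by simp
        ultimately show ?case using \<epsilon> by (simp add: dist_norm norm_minus_commute)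
      qed
    qed
    then have "E G = F f" by (rule E_eqI[OF G])
    then show "arens E F f = F f" using f by (simp add: arens_def G_def)
  qed
  have "bidual_one = E"
    unfolding bidual_one_def
  proof (rule the_equality)
    show "E \<in> bidual \<and> (\<forall>F\<in>bidual. arens E F = F \<and> arens F E = F)"
      using E left right by blast
    \<comment> \<open>Two identities agree: E' = E' E = E.\<close>
    show "E' = E" if "E' \<in> bidual \<and> (\<forall>F\<in>bidual. arens E' F = F \<and> arens F E' = F)" for E'
      using that E right by metis
  qed
  then show ?thesis by (simp add: E_def)
qed

text \<open>Existence is part of being a state; uniqueness holds because \<omega> is fixed by \<phi>
  and its value 1 at the identity.\<close>

lemma unitization_state_extension_unique:
  fixes \<phi> :: "'a::complex_banach_algebra \<Rightarrow> complex"
  assumes "state \<phi>"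
  shows "\<exists>!\<omega>. unitization_state \<omega> \<and> extends \<omega> \<phi>"
proof -
  have "\<omega> = \<omega>'" if "unitization_state \<omega>" "extends \<omega> \<phi>" "unitization_state \<omega>'" "extends \<omega>' \<phi>"
    for \<omega> \<omega>' :: "'a \<times> complex \<Rightarrow> complex"
  proof
    fix x :: "'a \<times> complex"
    show "\<omega> x = \<omega>' x"
      using unitization_state_decomp[OF that(1,2)] unitization_state_decomp[OF that(3,4)] by (cases x) simp
  qed
  then show ?thesis using assms unfolding state_def by blast
qed

theorem corollary4p25:
  fixes p :: real and M :: "'x measure"
  assumes "1 < p"
    and "Lp_operator_algebra p M TYPE('a::complex_banach_algebra)"
    and "\<not> unital TYPE('a)"
    and "approximately_unital TYPE('i) TYPE('a)"
  shows "(\<forall>\<phi> :: 'a \<Rightarrow> complex. \<phi> \<in> dual \<and> dual_norm \<phi> = 1 \<longrightarrow>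
            (state \<phi> \<longleftrightarrow>
              (\<forall>(\<Lambda>::'i set) r e. cai \<Lambda> r e \<longrightarrow> ((\<lambda>t. \<phi> (e t)) \<longlongrightarrow> 1) (tails \<Lambda> r))) \<and>
            (state \<phi> \<longleftrightarrow>
              (\<exists>(\<Lambda>::'i set) r e. cai \<Lambda> r e \<and> ((\<lambda>t. \<phi> (e t)) \<longlongrightarrow> 1) (tails \<Lambda> r))) \<and>
            (state \<phi> \<longleftrightarrow> bidual_extension \<phi> bidual_one = 1)) \<and>
         (\<forall>\<phi> :: 'a \<Rightarrow> complex. state \<phi> \<longrightarrow> (\<exists>!\<omega>. unitization_state \<omega> \<and> extends \<omega> \<phi>))"
proof -
  have smooth: "left_smooth TYPE('a)"
    using assms(1,2) by (rule Lp_operator_algebra_left_smooth)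
  \<comment> \<open>This one net computes \<open>bidual_one\<close>, instantiates the statement for
    all nets and witnesses the statement for some net.\<close>
  obtain \<Lambda>0 :: "'i set" and r0 and e0 :: "'i \<Rightarrow> 'a" where c0: "cai \<Lambda>0 r0 e0"
    using assms(4) unfolding approximately_unital_def by blast
  have "state \<phi> \<longleftrightarrow> bidual_extension \<phi> bidual_one = 1" if \<phi>: "\<phi> \<in> dual" "dual_norm \<phi> = 1" for \<phi> :: "'a \<Rightarrow> complex"
  proof -
    have lim: "((\<lambda>t. \<phi> (e0 t)) \<longlongrightarrow> bidual_extension \<phi> bidual_one) (tails \<Lambda>0 r0)"
      using dual_cai_convergent[OF smooth c0 \<phi>(1)] \<phi>(1)
      by (simp add: bidual_extension_def bidual_one_eq_Lim[OF smooth c0])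
    show ?thesis
    proof
      assume "state \<phi>"
      from tendsto_unique[OF cai_tails_neq_bot[OF c0] lim state_tendsto_one[OF smooth c0 this]]
      show "bidual_extension \<phi> bidual_one = 1" .
    next
      assume "bidual_extension \<phi> bidual_one = 1"
      then show "state \<phi>" using state_if_tendsto_one[OF c0 \<phi>] lim by simp
    qed
  qed
  moreover have "state \<phi> \<longleftrightarrow>
      (\<forall>(\<Lambda>::'i set) r e. cai \<Lambda> r e \<longrightarrow> ((\<lambda>t. \<phi> (e t)) \<longlongrightarrow> 1) (tails \<Lambda> r))"
    if \<phi>: "\<phi> \<in> dual" "dual_norm \<phi> = 1" for \<phi> :: "'a \<Rightarrow> complex"
  proof (intro iffI allI impI)
    fix \<Lambda> :: "'i set" and r and e :: "'i \<Rightarrow> 'a"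
    assume "state \<phi>" "cai \<Lambda> r e"
    then show "((\<lambda>t. \<phi> (e t)) \<longlongrightarrow> 1) (tails \<Lambda> r)"
      by (intro state_tendsto_one[OF smooth])
  next
    assume "\<forall>(\<Lambda>::'i set) r e. cai \<Lambda> r e \<longrightarrow> ((\<lambda>t. \<phi> (e t)) \<longlongrightarrow> 1) (tails \<Lambda> r)"
    then show "state \<phi>" using c0 state_if_tendsto_one[OF c0 \<phi>] by blast
  qed
  moreover have "state \<phi> \<longleftrightarrow>
      (\<exists>(\<Lambda>::'i set) r e. cai \<Lambda> r e \<and> ((\<lambda>t. \<phi> (e t)) \<longlongrightarrow> 1) (tails \<Lambda> r))"
    if \<phi>: "\<phi> \<in> dual" "dual_norm \<phi> = 1" for \<phi> :: "'a \<Rightarrow> complex"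
  proof
    assume "state \<phi>"
    then show "\<exists>(\<Lambda>::'i set) r e. cai \<Lambda> r e \<and> ((\<lambda>t. \<phi> (e t)) \<longlongrightarrow> 1) (tails \<Lambda> r)"
      using c0 state_tendsto_one[OF smooth c0] by blast
  next
    assume "\<exists>(\<Lambda>::'i set) r e. cai \<Lambda> r e \<and> ((\<lambda>t. \<phi> (e t)) \<longlongrightarrow> 1) (tails \<Lambda> r)"
    then show "state \<phi>" by (elim exE conjE) (rule state_if_tendsto_one[OF _ \<phi>])
  qed
  ultimately show ?thesis
    by (intro conjI allI impI unitization_state_extension_unique) simp_all
qed

end
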